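(* Let $\theta\in\mathbb R$. (i) \[\limsup_{\epsilon\to+0}\frac{1}{\epsilon^2}\left(\limsup_{n\to\infty}\frac{\log P(|\hat\theta_n-\theta|>\epsilon)}{n}\right)\le-\frac{m(2m-1)}{2(m+1)}\] and \[\liminf_{\epsilon\to+0}\frac{1}{\epsilon^2}\left(\liminf_{n\to\infty}\frac{\log P(|\hat\theta_n-\theta|>\epsilon)}{n}\right)\ge-\frac{m(2m-1)}{2(m+1)}.\] (ii) For every sequence $(\lambda_n)_n$ of positive numbers with $\lambda_n\to\infty$ and $\lambda_n/n^{1/2}\to0$, and every $\epsilon>0$, \[\lim_{n\to\infty}\frac{\log P(|\hat\theta_n-\theta|>\epsilon/\lambda_n)}{n/\lambda_n^2}=-\frac{m(2m-1)}{2(m+1)}\epsilon^2.\]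
   Context: Fix $m>1/2$. Let $c_m:=\left(\int_{\mathbb R}(1+x^2)^{-m}\,dx\right)^{-1}$ and $f(x):=c_m(1+x^2)^{-m}$. For $\theta\in\mathbb R$, $\mathrm{PVII}_m(\theta,1)$ denotes the Pearson Type VII distribution with location $\theta$ and scale $1$, i.e. the law with density $x\mapsto f(x-\theta)$. Let $(X_n)_{n\ge1}$ be i.i.d. random variables on a probability space $(\Omega,\mathcal F,P)$ with law $\mathrm{PVII}_m(\theta,1)$. For each $n$, let $\hat\theta_n(x_1,\dots,x_n)$ be any Borel measurable function on $\mathbb R^n$ such that $\hat\theta_n(x_1,\dots,x_n)$ is a maximizer of $t\mapsto\prod_{i=1}^n f(x_i-t)$ over $t\in\mathbb R$, and let $\hat\theta_n:=\hat\theta_n(X_1,\dots,X_n)$ (the maximum likelihood estimator). *)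

theory Defs
  imports "HOL-Probability.Probability"
begin

definition pvii_c :: "real \<Rightarrow> real" where
  "pvii_c m = inverse (integral\<^sup>L lborel (\<lambda>x::real. (1 + x\<^sup>2) powr (- m)))"

definition pvii_f :: "real \<Rightarrow> real \<Rightarrow> real" where
  "pvii_f m x = pvii_c m * (1 + x\<^sup>2) powr (- m)"

definition elog :: "real \<Rightarrow> ereal" where
  "elog p = (if p > 0 then ereal (ln p) else - \<infinity>)"

end

theory Submission
  imports Defs
begin

text \<open>
  Put \<open>\<psi>(y) = y / (1 + y\<^sup>2)\<close> and let \<open>Y = X - \<theta>\<close>. Outside an event of probability
  \<open>K exp (- c n)\<close> the score \<open>t \<mapsto> \<Sum> \<psi>(Y\<^sub>i - t)\<close> is strictly decreasing near \<open>0\<close> and the centred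
  estimator lies in that neighbourhood, so the estimator exceeds \<open>e\<close> iff \<open>\<Sum> \<psi>(Y\<^sub>i - e) > 0\<close>.
  The moment generating function of \<open>\<psi>(Y - e)\<close> at \<open>a e\<close> is
  \<open>1 + e\<^sup>2 V (a\<^sup>2 / 2 - 2 m a) + O(e\<^sup>3)\<close> with \<open>V = E \<psi>(Y)\<^sup>2\<close> and \<open>E \<psi>'(Y) = 2 m V\<close>. The minimum
  over \<open>a\<close> is at \<open>a = 2 m\<close>, with value \<open>- 2 m\<^sup>2 V\<close>. Chernoff's bound gives the upper estimate
  \<open>exp (- n e\<^sup>2 (2 m\<^sup>2 V - \<delta>))\<close>; tilting by \<open>a\<close> slightly above \<open>2 m\<close> gives the matching lower one.
  Both hold uniformly in \<open>n\<close> for small \<open>e\<close> with \<open>n e\<^sup>2\<close> large, which covers fixed \<open>e\<close> and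
  \<open>e = \<epsilon> / \<lambda>\<^sub>n\<close> at once.
\<close>

section \<open>Bounds and expansions for the score\<close>

text \<open>The derivative of the log-density in the location is \<open>2 * m * score\<close>, so
  \<open>4 * m\<^sup>2 * V\<close> is the Fisher information and the rate
  \<open>2 * m\<^sup>2 * V\<close> is half of it. The optimal tilt is \<open>2 * m\<close> because,
  to first order, weighting by \<open>exp (2 * m * e * score y)\<close> moves the location from 0 to
  \<open>e\<close>, and there the score at \<open>e\<close> is centred. The obstacle is that the
  log-likelihood is not concave: \<open>dscore\<close> is negative beyond 1 in absolute value, so
  the score equation may have several roots. The sign of the score sum locates a global maximizer
  only after all distant parameters are excluded. This exclusion may be crude: its rate
  \<open>c\<close> does not depend on \<open>e\<close>, so the exceptional event is of lower order
  than \<open>exp (- n * e\<^sup>2 * J)\<close> as soon as \<open>e\<^sup>2 * J < c\<close>.\<close>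

definition score :: "real \<Rightarrow> real" where
  "score y = y / (1 + y\<^sup>2)"

definition dscore :: "real \<Rightarrow> real" where
  "dscore y = (1 - y\<^sup>2) / (1 + y\<^sup>2)\<^sup>2"

lemma one_plus_square_pos [simp]: "0 < 1 + (x::real)\<^sup>2"
  by (simp add: add_pos_nonneg)

lemma one_plus_square_nonzero [simp]: "1 + (x::real)\<^sup>2 \<noteq> 0"
  using one_plus_square_pos[of x] by linarith

lemma abs_score_le: "\<bar>score y\<bar> \<le> 1/2"
proof -
  have "2 * \<bar>y\<bar> \<le> 1 + y\<^sup>2"
    using zero_le_power2[of "\<bar>y\<bar> - 1"] by (simp add: power2_diff)
  then show ?thesis
    by (simp add: score_def abs_divide divide_le_eq)
qed

lemma abs_dscore_le: "\<bar>dscore y\<bar> \<le> 1"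
proof -
  have "\<bar>1 - y\<^sup>2\<bar> \<le> 1 + y\<^sup>2"
    using zero_le_power2[of y] by linarith
  also have "\<dots> \<le> (1 + y\<^sup>2)\<^sup>2"
    by (rule self_le_power) auto
  finally show ?thesis
    by (simp add: dscore_def abs_divide)
qed

lemma score_minus: "score (- y) = - score y"
  by (simp add: score_def)

lemma has_derivative_score: "(score has_real_derivative dscore y) (at y within S)"
proof -
  have "((\<lambda>y. y / (1 + y\<^sup>2)) has_real_derivative dscore y) (at y within S)"
    by (rule derivative_eq_intros refl | simp)+
      (simp add: dscore_def power2_eq_square)
  then show ?thesis
    unfolding score_def[abs_def] .
qed

lemma has_derivative_dscore:
  "(dscore has_real_derivative (2 * y * (y\<^sup>2 - 3) / (1 + y\<^sup>2) ^ 3)) (at y within S)"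
proof -
  have "((\<lambda>y. (1 - y\<^sup>2) / (1 + y\<^sup>2)\<^sup>2) has_real_derivative
      (2 * y * (y\<^sup>2 - 3) / (1 + y\<^sup>2) ^ 3)) (at y within S)"
    apply (rule derivative_eq_intros refl | simp)+
    apply (simp add: divide_simps)
    apply (simp add: power_def)
    apply (simp add: algebra_simps)
    done
  then show ?thesis
    unfolding dscore_def[abs_def] .
qed

lemma abs_deriv_dscore_le: "\<bar>2 * y * (y\<^sup>2 - 3) / (1 + y\<^sup>2) ^ 3\<bar> \<le> (6::real)"
proof -
  have a: "2 * \<bar>y\<bar> \<le> 1 + y\<^sup>2"
    using zero_le_power2[of "\<bar>y\<bar> - 1"] by (simp add: power2_diff)
  have "\<bar>2 * y * (y\<^sup>2 - 3)\<bar> = (2 * \<bar>y\<bar>) * \<bar>y\<^sup>2 - 3\<bar>" by (simp add: abs_mult)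
  also have "\<dots> \<le> (1 + y\<^sup>2) * (3 * (1 + y\<^sup>2))"
    using a by (intro mult_mono) (auto simp: abs_if)
  also have "\<dots> = 3 * (1 + y\<^sup>2)\<^sup>2" by (simp add: power2_eq_square)
  also have "\<dots> \<le> 6 * (1 + y\<^sup>2)\<^sup>2" by simp
  also have "\<dots> \<le> 6 * (1 + y\<^sup>2) ^ 3"
    by (intro mult_left_mono power_increasing) auto
  finally show ?thesis
    by (simp add: abs_divide divide_le_eq)
qed

lemma lipschitz_real_deriv:
  fixes f :: "real \<Rightarrow> real"
  assumes "\<And>z. (f has_real_derivative f' z) (at z)" "\<And>z. \<bar>f' z\<bar> \<le> B"
  shows "\<bar>f x - f y\<bar> \<le> B * \<bar>x - y\<bar>"
  using field_differentiable_bound[of UNIV f f' B x y] assms by auto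

lemma dscore_lipschitz: "\<bar>dscore x - dscore y\<bar> \<le> 6 * \<bar>x - y\<bar>"
  by (rule lipschitz_real_deriv[OF has_derivative_dscore abs_deriv_dscore_le])

lemma score_lipschitz: "\<bar>score x - score y\<bar> \<le> \<bar>x - y\<bar>"
  using lipschitz_real_deriv[OF has_derivative_score abs_dscore_le] by simp

text \<open>Subtracting the tangent slope at \<open>y\<close> leaves a function whose derivative is
  at most \<open>6 * \<bar>e\<bar>\<close> on the ball around \<open>y\<close>. The Lipschitz bound
  for \<open>dscore\<close> suffices, at the price of a factor 2 in the constant.\<close>

lemma score_taylor: "\<bar>score (y - e) - score y + e * dscore y\<bar> \<le> 6 * e\<^sup>2"
proof -
  let ?g = "\<lambda>z. score z - z * dscore y"
  have d: "(?g has_real_derivative (dscore z - dscore y)) (at z within S)" for z S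
    by (rule derivative_eq_intros has_derivative_score refl | simp)+
  have "norm (?g (y - e) - ?g y) \<le> 6 * \<bar>e\<bar> * norm ((y - e) - y)"
  proof (rule field_differentiable_bound[where S = "cball y \<bar>e\<bar>"])
    show "norm (dscore z - dscore y) \<le> 6 * \<bar>e\<bar>" if "z \<in> cball y \<bar>e\<bar>" for z
      using dscore_lipschitz[of z y] that
      by (auto simp: dist_real_def abs_minus_commute[of y])
  qed (auto simp: dist_real_def intro: d)
  then show ?thesis
    by (simp add: algebra_simps power2_eq_square flip: abs_mult)
qed

lemma exp_taylor2:
  fixes x :: real
  assumes "\<bar>x\<bar> \<le> 1"
  shows "\<bar>exp x - 1 - x - x\<^sup>2 / 2\<bar> \<le> \<bar>x\<bar> ^ 3"
proof -
  obtain t where t: "\<bar>t\<bar> \<le> \<bar>x\<bar>" "exp x = (\<Sum>k<3. x ^ k / fact k) + exp t / fact 3 * x ^ 3"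
    using Maclaurin_exp_le[of x 3] by auto
  have "exp t \<le> exp 1" using t assms by simp
  also have "\<dots> \<le> 3" by (rule exp_le)
  finally have e: "exp t \<le> 3" .
  have "exp x - 1 - x - x\<^sup>2 / 2 = exp t / 6 * x ^ 3"
    using t(2) by (simp add: eval_nat_numeral)
  then have "\<bar>exp x - 1 - x - x\<^sup>2 / 2\<bar> = exp t / 6 * \<bar>x\<bar> ^ 3"
    by (simp only: abs_mult power_abs) simp
  also have "\<dots> \<le> 1 * \<bar>x\<bar> ^ 3"
    by (intro mult_right_mono) (use e in auto)
  finally show ?thesis by simp
qed

text \<open>Three errors of order \<open>e ^ 3\<close> add up: the cubic remainder of exp, the
  tangent error of the score in the linear term, and the shift from \<open>y - e\<close> to
  \<open>y\<close> in the quadratic term. The bound is uniform in \<open>y\<close>, so it survives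
  integration.\<close>

lemma exp_score_taylor:
  assumes a: "\<bar>a\<bar> \<le> A" and e: "0 \<le> e" "e \<le> 1" "A * e \<le> 1"
  shows "\<bar>exp (a * e * score (y - e))
      - (1 + a * e * score y + e\<^sup>2 * (a\<^sup>2 / 2 * (score y)\<^sup>2 - a * dscore y))\<bar>
    \<le> (A ^ 3 + A\<^sup>2 + 6 * A) * e ^ 3"
proof -
  define x where "x = a * e * score (y - e)"
  have A: "A \<ge> 0" using a by linarith
  have ae: "\<bar>a * e\<bar> \<le> A * e" using a e by (simp add: abs_mult mult_right_mono)
  have x: "\<bar>x\<bar> \<le> A * e"
  proof -
    have "\<bar>x\<bar> = \<bar>a * e\<bar> * \<bar>score (y - e)\<bar>" by (simp add: x_def abs_mult)
    also have "\<dots> \<le> (A * e) * 1"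
      using abs_score_le[of "y - e"] by (intro mult_mono ae) (auto simp: A e)
    finally show ?thesis by simp
  qed
  have 1: "\<bar>exp x - 1 - x - x\<^sup>2 / 2\<bar> \<le> A ^ 3 * e ^ 3"
  proof -
    have "\<bar>exp x - 1 - x - x\<^sup>2 / 2\<bar> \<le> \<bar>x\<bar> ^ 3"
      using x e by (intro exp_taylor2) auto
    also have "\<dots> \<le> (A * e) ^ 3" using x by (intro power_mono) auto
    finally show ?thesis by (simp add: power_mult_distrib)
  qed
  have 2: "\<bar>x - a * e * score y + a * e\<^sup>2 * dscore y\<bar> \<le> 6 * A * e ^ 3"
  proof -
    have "x - a * e * score y + a * e\<^sup>2 * dscore y
        = (a * e) * (score (y - e) - score y + e * dscore y)"
      by (simp add: x_def algebra_simps power2_eq_square)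
    then have "\<bar>x - a * e * score y + a * e\<^sup>2 * dscore y\<bar>
        = \<bar>a * e\<bar> * \<bar>score (y - e) - score y + e * dscore y\<bar>"
      by (simp add: abs_mult)
    also have "\<dots> \<le> (A * e) * (6 * e\<^sup>2)"
      by (intro mult_mono ae score_taylor) (auto simp: A e)
    finally show ?thesis by (simp add: eval_nat_numeral algebra_simps)
  qed
  have 3: "\<bar>x\<^sup>2 - (a * e * score y)\<^sup>2\<bar> \<le> 2 * A\<^sup>2 * e ^ 3"
  proof -
    have "x\<^sup>2 - (a * e * score y)\<^sup>2
        = (a * e)\<^sup>2 * ((score (y - e) - score y) * (score (y - e) + score y))"
      by (simp add: x_def algebra_simps power2_eq_square)
    then have "\<bar>x\<^sup>2 - (a * e * score y)\<^sup>2\<bar>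
        = \<bar>a * e\<bar>\<^sup>2 * (\<bar>score (y - e) - score y\<bar> * \<bar>score (y - e) + score y\<bar>)"
      by (simp only: abs_mult power2_abs power_abs)
    also have "\<dots> \<le> (A * e)\<^sup>2 * (e * 1)"
    proof (intro mult_mono power_mono ae)
      show "\<bar>score (y - e) - score y\<bar> \<le> e"
        using score_lipschitz[of "y - e" y] e by simp
      show "\<bar>score (y - e) + score y\<bar> \<le> 1"
        using abs_score_le[of "y - e"] abs_score_le[of y] by linarith
    qed (auto simp: A e)
    also have "\<dots> = A\<^sup>2 * e ^ 3" by (simp add: eval_nat_numeral algebra_simps)
    also have "\<dots> \<le> 2 * A\<^sup>2 * e ^ 3" using e by simp
    finally show ?thesis .
  qed
  have "exp x - (1 + a * e * score y + e\<^sup>2 * (a\<^sup>2 / 2 * (score y)\<^sup>2 - a * dscore y))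
      = (exp x - 1 - x - x\<^sup>2 / 2) + (x - a * e * score y + a * e\<^sup>2 * dscore y)
        + (x\<^sup>2 - (a * e * score y)\<^sup>2) / 2"
    by (simp add: field_simps power2_eq_square)
  also have "\<bar>\<dots>\<bar> \<le> A ^ 3 * e ^ 3 + 6 * A * e ^ 3 + A\<^sup>2 * e ^ 3"
  proof -
    have "\<bar>p + q + r / 2\<bar> \<le> P + Q + R"
      if "\<bar>p\<bar> \<le> P" "\<bar>q\<bar> \<le> Q" "\<bar>r\<bar> \<le> 2 * R" for p q r P Q R :: real
      using that by linarith
    from this[OF 1 2, of _ "A\<^sup>2 * e ^ 3"] 3 show ?thesis by simp
  qed
  finally show ?thesis by (simp add: x_def algebra_simps)
qed

text \<open>Up to the factor \<open>m\<close> and a constant this function is the negative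
  log-density, so a likelihood maximizer is a zero of the score sum.\<close>

lemma ln_one_plus_square_has_derivative:
  "((\<lambda>t. ln (1 + (x - t)\<^sup>2)) has_real_derivative - 2 * score (x - t)) (at t within S)"
  by (rule derivative_eq_intros refl | simp)+ (simp add: score_def field_simps)

text \<open>The constant 1 is twice the bound on \<open>score\<close>. Log-likelihood ratios are
  thus bounded although log-densities are not, which makes exponential bounds for bounded summands
  applicable.\<close>

lemma ln_one_plus_square_lipschitz:
  "\<bar>ln (1 + (x - t)\<^sup>2) - ln (1 + (x - s)\<^sup>2)\<bar> \<le> \<bar>t - (s::real)\<bar>"
proof -
  have "\<bar>- 2 * score (x - z)\<bar> \<le> 1" for z using abs_score_le[of "x - z"] by simp
  from lipschitz_real_deriv[OF ln_one_plus_square_has_derivative this] show ?thesis by simp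
qed

section \<open>Moments of the Pearson Type VII law\<close>

text \<open>Domination by 1 on [-1, 1] and, on either side, by a power of |x| with exponent below
  -1.\<close>

lemma integrable_powr_kernel:
  fixes k :: real
  assumes k: "k > 1/2"
  shows "integrable lborel (\<lambda>x. (1 + x\<^sup>2) powr (- k))"
proof -
  let ?g = "\<lambda>x::real. indicator {1..} x * x powr (-2 * k)"
  have "(\<lambda>x::real. x powr (-2 * k)) absolutely_integrable_on {1..}"
    using has_integral_powr_to_inf[of "-2 * k" 1] k
    by (intro nonnegative_absolutely_integrable_1) (auto simp: integrable_on_def)
  then have g: "integrable lborel ?g"
    unfolding set_integrable_def by (subst (asm) integrable_completion) auto
  then have g': "integrable lborel (\<lambda>x. ?g (0 + (-1) * x))"
    by (rule lborel_integrable_real_affine) auto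
  have i: "integrable lborel (\<lambda>x::real. indicator {-1..1} x :: real)"
    by (intro integrable_real_indicator) auto
  have "integrable lborel (\<lambda>x. indicator {-1..1} x + ?g x + ?g (0 + (-1) * x))"
    by (intro Bochner_Integration.integrable_add i g g')
  then show ?thesis
  proof (rule Bochner_Integration.integrable_bound)
    show "AE x in lborel. norm ((1 + x\<^sup>2) powr (- k)) \<le>
        norm (indicator {-1..1} x + ?g x + ?g (0 + (-1) * x))"
    proof (rule AE_I2)
      fix x :: real
      have tail: "(1 + y\<^sup>2) powr (- k) \<le> y powr (-2 * k)" if "y \<ge> 1" for y :: real
      proof -
        have "(1 + y\<^sup>2) powr (- k) \<le> (y\<^sup>2) powr (- k)"
          using that k by (intro powr_mono2') auto
        also have "(y\<^sup>2) powr (- k) = y powr (-2 * k)"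
          using that powr_powr[of y 2 "- k"] by simp
        finally show ?thesis .
      qed
      have mid: "(1 + x\<^sup>2) powr (- k) \<le> 1"
      proof -
        have "(1 + x\<^sup>2) powr (- k) \<le> (1 + x\<^sup>2) powr 0"
          using k by (intro powr_mono) auto
        then show ?thesis by simp
      qed
      consider "x \<in> {-1..1}" | "x > 1" | "x < -1" by force
      then show "norm ((1 + x\<^sup>2) powr (- k)) \<le>
          norm (indicator {-1..1} x + ?g x + ?g (0 + (-1) * x))"
      proof cases
        case 1
        then show ?thesis using mid by (auto simp: indicator_def)
      next
        case 2
        then show ?thesis using tail[of x] by (auto simp: indicator_def)
      next
        case 3
        then show ?thesis using tail[of "-x"] by (auto simp: indicator_def)
      qed
    qed
  qed measurable
qed

text \<open>Otherwise \<open>g\<close> vanishes almost everywhere, and the nonempty open set where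
  it is positive would be null.\<close>

lemma integral_lborel_pos:
  fixes g :: "real \<Rightarrow> real"
  assumes "integrable lborel g" "continuous_on UNIV g" "\<And>x. 0 \<le> g x" "g a > 0"
  shows "0 < integral\<^sup>L lborel g"
proof (rule ccontr)
  let ?S = "{x. 0 < g x}"
  assume "\<not> ?thesis"
  moreover have "0 \<le> integral\<^sup>L lborel g" using assms by simp
  ultimately have "integral\<^sup>L lborel g = 0" by simp
  then have "AE x in lborel. g x = 0"
    using assms by (subst (asm) integral_nonneg_eq_0_iff_AE) auto
  moreover have o: "open ?S"
    using assms by (intro open_Collect_less) auto
  ultimately have "?S \<in> null_sets lborel"
    by (subst AE_iff_null_sets) (auto elim!: eventually_mono)
  then have "negligible ?S"
    by (simp add: negligible_iff_null_sets null_sets_completionI)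
  moreover have "?S \<noteq> {}" using assms(4) by auto
  ultimately show False
    using open_not_negligible[OF o] by simp
qed

definition kernel_integral :: "real \<Rightarrow> real" where
  "kernel_integral k = integral\<^sup>L lborel (\<lambda>x::real. (1 + x\<^sup>2) powr (- k))"

lemma kernel_integral_pos: "k > 1/2 \<Longrightarrow> kernel_integral k > 0"
  unfolding kernel_integral_def
  by (rule integral_lborel_pos[where a = 0])
     (auto intro!: integrable_powr_kernel continuous_intros)

text \<open>
  The derivative of \<open>x (1 + x\<^sup>2) powr (- k)\<close> combines the kernels of exponents \<open>k\<close> and \<open>k + 1\<close>,
  which gives the recursion for the kernel integrals.
\<close>

lemma kernel_antiderivative_at_top:
  assumes k: "k > 1/2"
  shows "((\<lambda>x::real. x * (1 + x\<^sup>2) powr (- k)) \<longlongrightarrow> 0) at_top"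
proof (rule tendsto_sandwich)
  show "eventually (\<lambda>x::real. 0 \<le> x * (1 + x\<^sup>2) powr (- k)) at_top"
    using eventually_ge_at_top[of 0] by eventually_elim simp
  show "eventually (\<lambda>x::real. x * (1 + x\<^sup>2) powr (- k) \<le> x powr (1 - 2 * k)) at_top"
    using eventually_gt_at_top[of 0]
  proof eventually_elim
    case (elim x)
    have "x * (1 + x\<^sup>2) powr (- k) \<le> x * (x\<^sup>2) powr (- k)"
      using elim k by (intro mult_left_mono powr_mono2') auto
    also have "(x\<^sup>2) powr (- k) = x powr (-2 * k)"
      using elim powr_powr[of x 2 "- k"] by simp
    also have "x * x powr (-2 * k) = x powr (1 - 2 * k)"
      using elim powr_add[of x 1 "-2 * k"] by simp
    finally show ?case .
  qed
  show "((\<lambda>x::real. x powr (1 - 2 * k)) \<longlongrightarrow> 0) at_top"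
    using k by (intro tendsto_neg_powr filterlim_ident) auto
qed auto

lemma kernel_integral_plus_1:
  assumes k: "k > 1/2"
  shows "kernel_integral (k + 1) = (2 * k - 1) / (2 * k) * kernel_integral k"
proof -
  let ?F = "\<lambda>x::real. x * (1 + x\<^sup>2) powr (- k)"
  let ?f = "\<lambda>x::real. (1 - 2 * k) * (1 + x\<^sup>2) powr (- k) + 2 * k * (1 + x\<^sup>2) powr (- (k + 1))"
  have int: "integrable lborel (\<lambda>x::real. (1 + x\<^sup>2) powr (- k))"
       "integrable lborel (\<lambda>x::real. (1 + x\<^sup>2) powr (- (k + 1)))"
    using k by (auto intro!: integrable_powr_kernel simp del: minus_add_distrib)
  then have intf: "integrable lborel ?f"
    by (intro Bochner_Integration.integrable_add integrable_mult_right)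
  have der: "(?F has_real_derivative ?f x) (at x)" for x
  proof -
    have eq: "- k - 1 = - 1 - k" by simp
    have "(?F has_real_derivative ((1 + x\<^sup>2) powr (- k) - 2 * k * x\<^sup>2 * (1 + x\<^sup>2) powr (- 1 - k))) (at x)"
      by (rule derivative_eq_intros refl | simp)+ (simp add: power2_eq_square eq)
    moreover have p: "(1 + x\<^sup>2) powr (- k) = (1 + x\<^sup>2) * (1 + x\<^sup>2) powr (- 1 - k)"
      by (simp add: powr_diff powr_minus divide_inverse)
    have "(1 + x\<^sup>2) powr (- k) - 2 * k * x\<^sup>2 * (1 + x\<^sup>2) powr (- 1 - k) = ?f x"
      unfolding p by (simp add: algebra_simps)
    ultimately show ?thesis by simp
  qed
  have bot: "(?F \<longlongrightarrow> 0) at_bot"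
    unfolding at_bot_mirror filterlim_filtermap
    using tendsto_minus[OF kernel_antiderivative_at_top[OF k]] by simp
  have "(LBINT x=-\<infinity>..\<infinity>. ?f x) = 0 - 0"
  proof (rule interval_integral_FTC_integrable[where F = ?F])
    show "(?F has_vector_derivative ?f x) (at x)" for x
      using der by (simp add: has_real_derivative_iff_has_vector_derivative)
    show "isCont ?f x" for x by (intro continuous_intros) auto
    show "set_integrable lborel (einterval (-\<infinity>) \<infinity>) ?f"
      using intf by (simp add: set_integrable_def)
  qed (use kernel_antiderivative_at_top[OF k] bot in \<open>auto simp: ereal_tendsto_simps\<close>)
  then have "integral\<^sup>L lborel ?f = 0"
    by (simp add: interval_lebesgue_integral_def set_lebesgue_integral_def)
  also have "integral\<^sup>L lborel ?f = (1 - 2 * k) * kernel_integral k + 2 * k * kernel_integral (k + 1)"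
    unfolding kernel_integral_def
    using int by (subst Bochner_Integration.integral_add) auto
  finally show ?thesis using k by (simp add: field_simps)
qed

section \<open>The centred law and the moments of its score\<close>

definition pvii_law :: "real \<Rightarrow> real measure" where
  "pvii_law m = density lborel (\<lambda>x. ennreal (pvii_f m x))"

lemma sets_pvii_law [simp, measurable_cong]: "sets (pvii_law m) = sets borel"
  by (simp add: pvii_law_def)

lemma space_pvii_law [simp]: "space (pvii_law m) = UNIV"
  by (simp add: pvii_law_def)

lemma measurable_pvii_f [measurable]: "pvii_f m \<in> borel_measurable borel"
  unfolding pvii_f_def[abs_def] by measurable

lemma measurable_score [measurable]: "score \<in> borel_measurable borel"
  unfolding score_def[abs_def] by measurable

lemma measurable_dscore [measurable]: "dscore \<in> borel_measurable borel"
  unfolding dscore_def[abs_def] by measurable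

lemma continuous_pvii_f [continuous_intros]:
  "continuous_on S g \<Longrightarrow> continuous_on S (\<lambda>x. pvii_f m (g x))"
  unfolding pvii_f_def[abs_def] by (intro continuous_intros) auto

lemma pvii_c_eq: "pvii_c m = inverse (kernel_integral m)"
  by (simp add: pvii_c_def kernel_integral_def)

lemma pvii_f_minus: "pvii_f m (- x) = pvii_f m x"
  by (simp add: pvii_f_def)

text \<open>The form \<open>q / q\<^sup>2\<close> puts both powers over the denominator of
  \<open>dscore\<close> and of the squared score, so that these become differences of powers by
  comparing numerators.\<close>

lemma powr_minus_1_2:
  fixes q :: real
  assumes "q > 0"
  shows "q powr (- 1) = q / q\<^sup>2" "q powr (- 2) = 1 / q\<^sup>2"
  using assms by (simp_all add: powr_minus field_simps power2_eq_square)

context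
  fixes m :: real
  assumes m: "m > 1/2"
begin

lemma pvii_f_pos: "pvii_f m x > 0"
  using kernel_integral_pos[OF m] by (simp add: pvii_f_def pvii_c_eq)

lemma pvii_f_nonneg: "pvii_f m x \<ge> 0"
  using pvii_f_pos[of x] by simp

lemma integrable_pvii_f: "integrable lborel (pvii_f m)"
  unfolding pvii_f_def[abs_def] by (intro integrable_mult_right integrable_powr_kernel m)

lemma integral_pvii_law:
  fixes g :: "real \<Rightarrow> real"
  assumes [measurable]: "g \<in> borel_measurable borel"
  shows "integral\<^sup>L (pvii_law m) g = (\<integral>x. pvii_f m x * g x \<partial>lborel)"
  unfolding pvii_law_def by (subst integral_density) (auto simp: pvii_f_nonneg)

lemma integrable_pvii_law_iff:
  fixes g :: "real \<Rightarrow> real"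
  assumes [measurable]: "g \<in> borel_measurable borel"
  shows "integrable (pvii_law m) g \<longleftrightarrow> integrable lborel (\<lambda>x. pvii_f m x * g x)"
  unfolding pvii_law_def by (subst integrable_density) (auto simp: pvii_f_nonneg)

lemma distr_pvii_law_uminus: "distr (pvii_law m) borel uminus = pvii_law m"
proof -
  have "distr (density lborel (\<lambda>x. ennreal (pvii_f m x))) borel uminus
      = density (distr lborel borel uminus) (\<lambda>x. ennreal (pvii_f m x))"
    by (subst density_distr) (auto simp: pvii_f_minus)
  also have "distr lborel borel uminus = (lborel :: real measure)"
    by (rule lborel_distr_uminus)
  finally show ?thesis by (simp add: pvii_law_def)
qed

lemma integral_pvii_law_uminus:
  fixes g :: "real \<Rightarrow> real"
  assumes [measurable]: "g \<in> borel_measurable borel"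
  shows "(\<integral>x. g (- x) \<partial>pvii_law m) = (\<integral>x. g x \<partial>pvii_law m)"
proof -
  have "(\<integral>x. g x \<partial>distr (pvii_law m) borel uminus) = (\<integral>x. g (- x) \<partial>pvii_law m)"
    by (rule integral_distr) auto
  then show ?thesis by (simp add: distr_pvii_law_uminus)
qed

lemma integral_score: "integral\<^sup>L (pvii_law m) score = 0"
  using integral_pvii_law_uminus[of score] by (simp add: score_minus)

text \<open>The closed form of the second moment of \<open>score\<close>, confirmed by
  \<open>integral_score_square\<close>.\<close>

definition score_var :: real where
  "score_var = (2 * m - 1) / (4 * m * (m + 1))"

lemma score_var_pos: "score_var > 0"
  using m by (simp add: score_var_def)

lemma integral_powr_pvii_law:
  assumes "j \<ge> 0"
  shows "integrable (pvii_law m) (\<lambda>x. (1 + x\<^sup>2) powr (- j))"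
    and "(\<integral>x. (1 + x\<^sup>2) powr (- j) \<partial>pvii_law m) = kernel_integral (m + j) / kernel_integral m"
proof -
  have eq: "pvii_f m x * (1 + x\<^sup>2) powr (- j) = pvii_c m * (1 + x\<^sup>2) powr (- (m + j))" for x
    unfolding pvii_f_def by (simp add: powr_add powr_minus field_simps powr_diff)
  have "integrable lborel (\<lambda>x. (1 + x\<^sup>2) powr (- (m + j)))"
    using m assms by (intro integrable_powr_kernel) auto
  then show "integrable (pvii_law m) (\<lambda>x. (1 + x\<^sup>2) powr (- j))"
    by (subst integrable_pvii_law_iff) (simp_all only: eq, auto intro!: integrable_mult_right)
  show "(\<integral>x. (1 + x\<^sup>2) powr (- j) \<partial>pvii_law m) = kernel_integral (m + j) / kernel_integral m"
    by (subst integral_pvii_law)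
       (simp_all only: eq, simp_all add: kernel_integral_def pvii_c_eq field_simps)
qed

lemma kernel_ratio:
  "kernel_integral (m + 1) / kernel_integral m = (2 * m - 1) / (2 * m)"
  "kernel_integral (m + 2) / kernel_integral m = (2 * m - 1) / (2 * m) * ((2 * m + 1) / (2 * (m + 1)))"
proof -
  have 1: "kernel_integral (m + 1) = (2 * m - 1) / (2 * m) * kernel_integral m"
    by (rule kernel_integral_plus_1[OF m])
  have "kernel_integral (m + 2) = (2 * m + 1) / (2 * (m + 1)) * kernel_integral (m + 1)"
    using kernel_integral_plus_1[of "m + 1"] m by (simp add: algebra_simps)
  then show "kernel_integral (m + 2) / kernel_integral m = (2 * m - 1) / (2 * m) * ((2 * m + 1) / (2 * (m + 1)))"
    using kernel_integral_pos[OF m] by (simp add: 1 mult.commute)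
  show "kernel_integral (m + 1) / kernel_integral m = (2 * m - 1) / (2 * m)"
    using kernel_integral_pos[OF m] by (simp add: 1)
qed

lemma integral_score_square: "(\<integral>x. (score x)\<^sup>2 \<partial>pvii_law m) = score_var"
proof -
  have "(score x)\<^sup>2 = (1 + x\<^sup>2) powr (- 1) - (1 + x\<^sup>2) powr (- 2)" for x
    by (simp only: powr_minus_1_2[OF one_plus_square_pos])
       (simp add: score_def power_divide flip: diff_divide_distrib)
  then have "(\<integral>x. (score x)\<^sup>2 \<partial>pvii_law m) =
      kernel_integral (m + 1) / kernel_integral m - kernel_integral (m + 2) / kernel_integral m"
    using integral_powr_pvii_law[of 1] integral_powr_pvii_law[of 2]
    by (simp only: Bochner_Integration.integral_diff zero_le_one zero_le_numeral)
  also have "\<dots> = score_var"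
    unfolding kernel_ratio score_var_def using m by (simp add: divide_simps) algebra
  finally show ?thesis .
qed

text \<open>This is the information identity: the density has derivative
  \<open>- 2 * m * score\<close> times itself, which explains the factor \<open>2 * m\<close>. Here
  it is read off from the kernel ratios.\<close>

lemma integral_dscore: "(\<integral>x. dscore x \<partial>pvii_law m) = 2 * m * score_var"
proof -
  have "dscore x = 2 * (1 + x\<^sup>2) powr (- 2) - (1 + x\<^sup>2) powr (- 1)" for x
    by (simp only: powr_minus_1_2[OF one_plus_square_pos])
       (simp add: dscore_def flip: diff_divide_distrib)
  then have "(\<integral>x. dscore x \<partial>pvii_law m) =
      2 * (kernel_integral (m + 2) / kernel_integral m) - kernel_integral (m + 1) / kernel_integral m"
    using integral_powr_pvii_law[of 1] integral_powr_pvii_law[of 2]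
    by (simp only: Bochner_Integration.integral_diff zero_le_one zero_le_numeral
        integrable_mult_right integral_mult_right_zero)
  also have "\<dots> = 2 * m * score_var"
    unfolding kernel_ratio score_var_def using m by (simp add: divide_simps) algebra
  finally show ?thesis .
qed

end

section \<open>Exponential bounds for sums of i.i.d. variables\<close>

locale iid_sample = prob_space M for M :: "'a measure" +
  fixes D :: "real measure" and Y :: "nat \<Rightarrow> 'a \<Rightarrow> real"
  assumes indep: "indep_vars (\<lambda>_. borel) Y UNIV"
    and distr_Y: "distr M borel (Y i) = D"
begin

lemma measurable_Y [measurable]: "Y i \<in> borel_measurable M"
  using indep by (auto simp: indep_vars_def)

lemma sets_D [simp, measurable_cong]: "sets D = sets borel"
  using distr_Y[of 0] by auto

lemma space_D [simp]: "space D = UNIV"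
  using distr_Y[of 0] by auto

lemma prob_space_D: "prob_space D"
  using prob_space_distr[of "Y 0" borel] distr_Y[of 0] by simp

lemma measure_D_UNIV [simp]: "measure D UNIV = 1"
  using prob_space.prob_space[OF prob_space_D] by simp

lemma integrable_D_bounded:
  fixes g :: "real \<Rightarrow> real"
  assumes [measurable]: "g \<in> borel_measurable borel" and "\<And>x. \<bar>g x\<bar> \<le> C"
  shows "integrable D g"
proof -
  interpret D: prob_space D by (rule prob_space_D)
  show ?thesis
    by (rule D.integrable_const_bound[where B = C]) (use assms(2) in auto)
qed

lemma integrable_D_const [simp]: "integrable D (\<lambda>x. c :: real)"
  by (rule integrable_D_bounded[where C = "\<bar>c\<bar>"]) auto

lemma
  assumes g [measurable]: "g \<in> borel_measurable borel" and bd: "\<And>x. \<bar>g x\<bar> \<le> (C::real)"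
  shows integrable_exp_sum: "integrable M (\<lambda>\<omega>. exp (\<Sum>i<n. g (Y i \<omega>)))"
    and expectation_exp_sum: "(\<integral>\<omega>. exp (\<Sum>i<n. g (Y i \<omega>)) \<partial>M) = (\<integral>x. exp (g x) \<partial>D) ^ n"
proof -
  have ind: "indep_vars (\<lambda>_. borel) (\<lambda>i \<omega>. exp (g (Y i \<omega>))) {..<n}"
    by (rule indep_vars_compose2[where M' = "\<lambda>_. borel"])
       (auto intro: indep_vars_subset[OF indep])
  have int: "integrable M (\<lambda>\<omega>. exp (g (Y i \<omega>)))" for i
  proof (rule integrable_const_bound[where B = "exp C"])
    have "g x \<le> C" for x using bd[of x] by linarith
    then show "AE \<omega> in M. norm (exp (g (Y i \<omega>))) \<le> exp C" by simp
  qed measurable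
  have E: "(\<integral>\<omega>. exp (g (Y i \<omega>)) \<partial>M) = (\<integral>x. exp (g x) \<partial>D)" for i
    unfolding distr_Y[of i, symmetric] by (subst integral_distr) auto
  show "integrable M (\<lambda>\<omega>. exp (\<Sum>i<n. g (Y i \<omega>)))"
    using indep_vars_integrable[OF _ ind int] by (simp add: exp_sum)
  show "(\<integral>\<omega>. exp (\<Sum>i<n. g (Y i \<omega>)) \<partial>M) = (\<integral>x. exp (g x) \<partial>D) ^ n"
    using indep_vars_lebesgue_integral[OF _ ind int] by (simp add: exp_sum E)
qed

text \<open>The tilt is part of \<open>g\<close>. The event is non-strict because left deviations of
  the estimator lead to the complement of a strict event for the reflected sample.\<close>

lemma chernoff_bound:
  assumes g [measurable]: "g \<in> borel_measurable borel" and bd: "\<And>x. \<bar>g x\<bar> \<le> (C::real)"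
  shows "prob {\<omega> \<in> space M. 0 \<le> (\<Sum>i<n. g (Y i \<omega>))} \<le> (\<integral>x. exp (g x) \<partial>D) ^ n"
proof -
  let ?A = "{\<omega> \<in> space M. 0 \<le> (\<Sum>i<n. g (Y i \<omega>))}"
  have "prob ?A = (\<integral>\<omega>. indicator ?A \<omega> \<partial>M)"
    by simp
  also have "\<dots> \<le> (\<integral>\<omega>. exp (\<Sum>i<n. g (Y i \<omega>)) \<partial>M)"
    by (intro integral_mono integrable_exp_sum[OF g bd] integrable_real_indicator)
       (auto simp: indicator_def emeasure_eq_measure)
  finally show ?thesis by (simp add: expectation_exp_sum[OF g bd])
qed

lemma exponential_decay:
  assumes g [measurable]: "g \<in> borel_measurable borel" and bd: "\<And>x. \<bar>g x\<bar> \<le> (C::real)"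
    and neg: "integral\<^sup>L D g < 0"
  shows "\<exists>q. 0 < q \<and> q < 1 \<and> (\<forall>n. prob {\<omega> \<in> space M. 0 \<le> (\<Sum>i<n. g (Y i \<omega>))} \<le> q ^ n)"
proof -
  interpret D: prob_space D by (rule prob_space_D)
  define c where "c = - integral\<^sup>L D g"
  define K where "K = max C 1"
  \<comment> \<open>The first bound keeps \<open>s * g x\<close> in the range of
    \<open>exp_taylor2\<close>; the second makes the quadratic term at most
    \<open>s * c / 2\<close>, half of the drift \<open>s * c\<close>.\<close>
  define s where "s = min (1 / K) (c / (3 * K\<^sup>2))"
  have K: "K \<ge> 1" "\<And>x. \<bar>g x\<bar> \<le> K"
    using bd by (auto simp: K_def le_max_iff_disj)
  have c: "c > 0" using neg by (simp add: c_def)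
  have s: "s > 0" "s * K \<le> 1" "s * (3 * K\<^sup>2) \<le> c"
    using K(1) c by (auto simp: s_def min_def field_simps)
  have sg: "\<bar>s * g x\<bar> \<le> s * K" for x
    using s K(2)[of x] by (simp add: abs_mult)
  have quad: "exp (s * g x) \<le> 1 + s * g x + s * c / 2" for x
  proof -
    let ?y = "s * g x"
    have y: "\<bar>?y\<bar> \<le> 1" using sg[of x] s by linarith
    have "\<bar>?y\<bar> ^ 3 \<le> \<bar>?y\<bar>\<^sup>2" using y by (intro power_decreasing) auto
    then have "exp ?y \<le> 1 + ?y + 3 / 2 * \<bar>?y\<bar>\<^sup>2"
      using exp_taylor2[OF y] by simp
    also have "\<bar>?y\<bar>\<^sup>2 \<le> (s * K)\<^sup>2" using sg[of x] by (intro power_mono) auto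
    also have "3 / 2 * (s * K)\<^sup>2 = s / 2 * (s * (3 * K\<^sup>2))" by (simp add: power2_eq_square)
    also have "\<dots> \<le> s / 2 * c" using s by (intro mult_left_mono) auto
    finally show ?thesis by simp
  qed
  have int: "integrable D (\<lambda>x. exp (s * g x))"
  proof (rule D.integrable_const_bound[where B = "exp 1"])
    have "s * g x \<le> 1" for x using sg[of x] s by linarith
    then show "AE x in D. norm (exp (s * g x)) \<le> exp 1" by simp
  qed measurable
  have intg: "integrable D g" by (rule integrable_D_bounded[OF g bd])
  define q where "q = (\<integral>x. exp (s * g x) \<partial>D)"
  have "q \<le> (\<integral>x. 1 + s * g x + s * c / 2 \<partial>D)"
    unfolding q_def using quad intg by (intro integral_mono int) auto
  also have "\<dots> = 1 - s * c / 2"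
    using intg by (simp add: c_def)
  also have "\<dots> < 1" using s c by simp
  finally have "q < 1" .
  \<comment> \<open>Positivity of \<open>q\<close> allows its powers to be rewritten later with
    \<open>ln q\<close>.\<close>
  moreover have "0 < q"
  proof -
    have "exp (-1) \<le> exp (s * g x)" for x using sg[of x] s by simp
    then have "(\<integral>x. exp (-1) \<partial>D) \<le> q"
      unfolding q_def by (intro integral_mono int) auto
    then show ?thesis
      using less_le_trans[OF exp_gt_zero[of "-1::real"]] by simp
  qed
  moreover have "prob {\<omega> \<in> space M. 0 \<le> (\<Sum>i<n. g (Y i \<omega>))} \<le> q ^ n" for n
    using chernoff_bound[of "\<lambda>x. s * g x" "s * K" n] sg s(1)
    by (simp add: q_def zero_le_mult_iff flip: sum_distrib_left)
  ultimately show ?thesis by blast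
qed

text \<open>
  Reweighting by \<open>exp (s T)\<close>, \<open>T\<close> the sum, and discarding \<open>T \<le> 0\<close> and \<open>T > b n\<close> by Markov bounds
  with the tilts \<open>s - u\<close> and \<open>s + u\<close>, so that no change of measure is needed.
\<close>

lemma tilting_lower_bound:
  assumes g [measurable]: "g \<in> borel_measurable borel" and bd: "\<And>x. \<bar>g x\<bar> \<le> (C::real)"
    and s: "0 \<le> s" and u: "0 \<le> u"
  defines "Z \<equiv> \<lambda>s. \<integral>x. exp (s * g x) \<partial>D"
  shows "exp (- s * b * n) * (Z s ^ n - Z (s - u) ^ n - exp (- u * b * n) * Z (s + u) ^ n)
    \<le> prob {\<omega> \<in> space M. 0 < (\<Sum>i<n. g (Y i \<omega>))}"
proof -
  let ?T = "\<lambda>\<omega>. \<Sum>i<n. g (Y i \<omega>)"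
  let ?A = "{\<omega> \<in> space M. 0 < ?T \<omega>}"
  have meas: "(\<lambda>x. v * g x) \<in> borel_measurable borel" for v by measurable
  have bdv: "\<bar>v * g x\<bar> \<le> \<bar>v\<bar> * C" for v x
    using bd[of x] by (simp add: abs_mult mult_left_mono)
  have int: "integrable M (\<lambda>\<omega>. exp (v * ?T \<omega>))" for v
    using integrable_exp_sum[OF meas bdv, of v n] by (simp add: sum_distrib_left)
  have E: "(\<integral>\<omega>. exp (v * ?T \<omega>) \<partial>M) = Z v ^ n" for v
    using expectation_exp_sum[OF meas bdv, of v n] by (simp add: sum_distrib_left Z_def)
  \<comment> \<open>On each of the ranges t \<le> 0, 0 < t \<le> b n and t > b n a single term
    dominates \<open>exp (s * t)\<close>: the tilt \<open>s - u\<close>, the right-hand side, and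
    the tilt \<open>s + u\<close> respectively.\<close>
  have pointwise: "exp (s * t) - exp ((s - u) * t) - exp (- u * b * n) * exp ((s + u) * t)
      \<le> exp (s * b * n) * (if 0 < t then 1 else 0)" for t
  proof -
    consider "t \<le> 0" | "0 < t" "t \<le> b * n" | "b * n < t" "0 < t" by linarith
    then show ?thesis
    proof cases
      case 1
      then have "s * t \<le> (s - u) * t"
        using u by (simp add: algebra_simps mult_nonpos_nonneg)
      then have "exp (s * t) \<le> exp ((s - u) * t)" by simp
      moreover have "0 \<le> exp (- u * b * n) * exp ((s + u) * t)" by simp
      ultimately have "exp (s * t) - exp ((s - u) * t) - exp (- u * b * n) * exp ((s + u) * t) \<le> 0"
        by linarith
      then show ?thesis using 1 by simp
    next
      case 2
      then have "exp (s * t) \<le> exp (s * b * n)"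
        using s mult_left_mono[of t "b * n" s] by (simp add: mult.assoc)
      moreover have "0 \<le> exp ((s - u) * t)" "0 \<le> exp (- u * b * n) * exp ((s + u) * t)" by simp_all
      ultimately have "exp (s * t) - exp ((s - u) * t) - exp (- u * b * n) * exp ((s + u) * t)
          \<le> exp (s * b * n)"
        by linarith
      then show ?thesis using 2 by simp
    next
      case 3
      have "s * t \<le> - u * b * n + (s + u) * t"
        using 3 u mult_left_mono[of "b * n" t u] by (simp add: algebra_simps)
      then have "exp (s * t) \<le> exp (- u * b * n) * exp ((s + u) * t)"
        by (simp flip: exp_add)
      moreover have "0 \<le> exp ((s - u) * t)" "0 \<le> exp (s * b * n)" by simp_all
      ultimately have "exp (s * t) - exp ((s - u) * t) - exp (- u * b * n) * exp ((s + u) * t)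
          \<le> exp (s * b * n)"
        by linarith
      then show ?thesis using 3 by simp
    qed
  qed
  have "Z s ^ n - Z (s - u) ^ n - exp (- u * b * n) * Z (s + u) ^ n
      = (\<integral>\<omega>. exp (s * ?T \<omega>) - exp ((s - u) * ?T \<omega>) - exp (- u * b * n) * exp ((s + u) * ?T \<omega>) \<partial>M)"
    using int by (simp add: E)
  also have "\<dots> \<le> (\<integral>\<omega>. exp (s * b * n) * indicator ?A \<omega> \<partial>M)"
  proof (intro integral_mono)
    fix \<omega> assume "\<omega> \<in> space M"
    then show "exp (s * ?T \<omega>) - exp ((s - u) * ?T \<omega>) - exp (- u * b * n) * exp ((s + u) * ?T \<omega>)
        \<le> exp (s * b * n) * indicator ?A \<omega>"
      using pointwise[of "?T \<omega>"] unfolding indicator_def by (auto split: if_splits)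
  qed (use int in \<open>auto simp: emeasure_eq_measure\<close>)
  also have "\<dots> = exp (s * b * n) * prob ?A" by simp
  finally have "exp (- (s * b * n)) * (Z s ^ n - Z (s - u) ^ n - exp (- u * b * n) * Z (s + u) ^ n)
      \<le> exp (- (s * b * n)) * (exp (s * b * n) * prob ?A)"
    by (intro mult_left_mono) auto
  also have "\<dots> = prob ?A" by (simp add: mult.assoc[symmetric] flip: exp_add)
  finally show ?thesis by simp
qed

end

section \<open>Deviations of the score sum\<close>

locale pvii_sample = iid_sample M "pvii_law m" Y
  for M :: "'a measure" and m :: real and Y :: "nat \<Rightarrow> 'a \<Rightarrow> real" +
  assumes m: "m > 1/2"
begin

abbreviation V :: real where "V \<equiv> score_var m"

text \<open>The tilt is proportional to \<open>e\<close> because the mean of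
  \<open>score (x - e)\<close> is of order \<open>e\<close>; drift and variance then both contribute
  at order \<open>e\<^sup>2\<close>.\<close>

abbreviation tilted_mgf :: "real \<Rightarrow> real \<Rightarrow> real" where
  "tilted_mgf a e \<equiv> \<integral>x. exp (a * e * score (x - e)) \<partial>pvii_law m"

lemma tilted_mgf_expansion:
  assumes a: "\<bar>a\<bar> \<le> A" and e: "0 \<le> e" "e \<le> 1" "A * e \<le> 1"
  shows "\<bar>tilted_mgf a e - (1 + e\<^sup>2 * (V * (a\<^sup>2 / 2 - 2 * m * a)))\<bar> \<le> (A ^ 3 + A\<^sup>2 + 6 * A) * e ^ 3"
proof -
  let ?K = "(A ^ 3 + A\<^sup>2 + 6 * A) * e ^ 3"
  let ?g = "\<lambda>y. 1 + a * e * score y + e\<^sup>2 * (a\<^sup>2 / 2 * (score y)\<^sup>2 - a * dscore y)"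
  have i1: "integrable (pvii_law m) score"
    by (rule integrable_D_bounded[OF _ abs_score_le]) measurable
  have i2: "integrable (pvii_law m) (\<lambda>y. (score y)\<^sup>2)"
  proof (rule integrable_D_bounded[where C = "(1/2)\<^sup>2"])
    show "\<bar>(score x)\<^sup>2\<bar> \<le> (1/2)\<^sup>2" for x
      using power_mono[OF abs_score_le[of x], of 2] by simp
  qed measurable
  have id: "integrable (pvii_law m) dscore"
    by (rule integrable_D_bounded[OF _ abs_dscore_le]) measurable
  have ig: "integrable (pvii_law m) ?g"
    by (intro Bochner_Integration.integrable_add Bochner_Integration.integrable_diff
        integrable_mult_right i1 i2 id integrable_D_const)
  have ie: "integrable (pvii_law m) (\<lambda>y. exp (a * e * score (y - e)))"
  proof (rule integrable_D_bounded[where C = "exp (\<bar>a * e\<bar> * (1/2))"])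
    fix x
    have "a * e * score (x - e) \<le> \<bar>a * e\<bar> * \<bar>score (x - e)\<bar>"
      using abs_ge_self[of "a * e * score (x - e)"] by (simp add: abs_mult)
    also have "\<dots> \<le> \<bar>a * e\<bar> * (1/2)" by (intro mult_left_mono abs_score_le) auto
    finally show "\<bar>exp (a * e * score (x - e))\<bar> \<le> exp (\<bar>a * e\<bar> * (1/2))" by simp
  qed measurable
  have "(\<integral>y. ?g y \<partial>pvii_law m) = 1 + e\<^sup>2 * (V * (a\<^sup>2 / 2 - 2 * m * a))"
    using i1 i2 id
    by (simp add: integral_score[OF m] integral_score_square[OF m] integral_dscore[OF m]
        algebra_simps)
  then have "\<bar>tilted_mgf a e - (1 + e\<^sup>2 * (V * (a\<^sup>2 / 2 - 2 * m * a)))\<bar>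
      = \<bar>\<integral>y. exp (a * e * score (y - e)) - ?g y \<partial>pvii_law m\<bar>"
    using ig ie by simp
  also have "\<dots> \<le> (\<integral>y. \<bar>exp (a * e * score (y - e)) - ?g y\<bar> \<partial>pvii_law m)"
    by (rule integral_abs_bound)
  also have "\<dots> \<le> (\<integral>y. ?K \<partial>pvii_law m)"
    using ig ie by (intro integral_mono exp_score_taylor a e) auto
  also have "\<dots> = ?K" by simp
  finally show ?thesis .
qed

text \<open>With \<open>w\<close> the difference quotient of the moment generating function,
  \<open>w\<close> tends to the constant at speed \<open>e\<close>, and replacing ln(1 + x) by x at
  \<open>x = e\<^sup>2 * w e\<close> costs at most \<open>2 * e\<^sup>2 * (w e)\<^sup>2\<close>
  after division by \<open>e\<^sup>2\<close>.\<close>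

lemma ln_tilted_mgf_asymp:
  "((\<lambda>e. ln (tilted_mgf a e) / e\<^sup>2) \<longlongrightarrow> V * (a\<^sup>2 / 2 - 2 * m * a)) (at_right 0)"
proof -
  define c where "c = V * (a\<^sup>2 / 2 - 2 * m * a)"
  define K where "K = \<bar>a\<bar> ^ 3 + \<bar>a\<bar>\<^sup>2 + 6 * \<bar>a\<bar>"
  have ev: "\<forall>\<^sub>F e in at_right 0. 0 < e \<and> e < b" if "b > 0" for b :: real
    using eventually_at_right_less that
    by (simp add: eventually_at_right_field) (auto intro: exI[of _ b])
  define w where "w = (\<lambda>e. (tilted_mgf a e - 1) / e\<^sup>2)"
  have b: "0 < min 1 (1 / (\<bar>a\<bar> + 1))" by simp
  have w_bound: "\<forall>\<^sub>F e in at_right 0. norm (w e - c) \<le> K * e"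
    using b[THEN ev]
  proof (eventually_elim)
    case (elim e)
    then have "0 < e" "e * \<bar>a\<bar> + e < 1" by (auto simp: field_simps)
    moreover from this have "0 \<le> e * \<bar>a\<bar>" by simp
    ultimately have e: "0 < e" "e \<le> 1" "\<bar>a\<bar> * e \<le> 1"
      unfolding mult.commute[of "\<bar>a\<bar>"] by linarith+
    from tilted_mgf_expansion[of a "\<bar>a\<bar>" e] e
    have "\<bar>tilted_mgf a e - 1 - e\<^sup>2 * c\<bar> \<le> K * e ^ 3"
      by (simp add: c_def K_def algebra_simps)
    then have "\<bar>(tilted_mgf a e - 1 - e\<^sup>2 * c) / e\<^sup>2\<bar> \<le> K * e ^ 3 / e\<^sup>2"
      unfolding abs_divide by (simp add: divide_right_mono)
    moreover have "(tilted_mgf a e - 1 - e\<^sup>2 * c) / e\<^sup>2 = w e - c"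
      using e by (simp add: w_def field_simps)
    moreover have "K * e ^ 3 / e\<^sup>2 = K * e"
      using e by (simp add: eval_nat_numeral)
    ultimately show ?case by simp
  qed
  have "((\<lambda>e. K * e) \<longlongrightarrow> K * 0) (at_right 0)"
    by (intro tendsto_intros)
  then have "((\<lambda>e. w e - c) \<longlongrightarrow> 0) (at_right 0)"
    by (intro Lim_null_comparison[OF w_bound]) simp
  then have w: "(w \<longlongrightarrow> c) (at_right 0)"
    by (simp add: LIM_zero_iff)
  have id: "((\<lambda>e::real. e) \<longlongrightarrow> 0) (at_right 0)"
    by (rule tendsto_ident_at)
  have y0: "((\<lambda>e. e\<^sup>2 * w e) \<longlongrightarrow> 0) (at_right 0)"
    using tendsto_mult[OF tendsto_power[OF id, of 2] w] by simp
  have "\<forall>\<^sub>F e in at_right 0. \<bar>e\<^sup>2 * w e\<bar> < 1/2"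
    using tendstoD[OF y0, of "1/2"] by simp
  then have d1: "\<forall>\<^sub>F e in at_right 0. norm (ln (tilted_mgf a e) / e\<^sup>2 - w e) \<le> 2 * e\<^sup>2 * (w e)\<^sup>2"
    using ev[of 1, OF zero_less_one]
  proof eventually_elim
    case (elim e)
    have "tilted_mgf a e = 1 + e\<^sup>2 * w e" using elim by (simp add: w_def)
    then have "\<bar>ln (tilted_mgf a e) - e\<^sup>2 * w e\<bar> \<le> 2 * (e\<^sup>2 * w e)\<^sup>2"
      using abs_ln_one_plus_x_minus_x_bound[of "e\<^sup>2 * w e"] elim by simp
    then have "\<bar>(ln (tilted_mgf a e) - e\<^sup>2 * w e) / e\<^sup>2\<bar> \<le> 2 * (e\<^sup>2 * w e)\<^sup>2 / e\<^sup>2"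
      unfolding abs_divide by (simp add: divide_right_mono)
    moreover have "(ln (tilted_mgf a e) - e\<^sup>2 * w e) / e\<^sup>2 = ln (tilted_mgf a e) / e\<^sup>2 - w e"
      using elim by (simp add: field_simps)
    moreover have "2 * (e\<^sup>2 * w e)\<^sup>2 / e\<^sup>2 = 2 * e\<^sup>2 * (w e)\<^sup>2"
      using elim by (simp add: field_simps power2_eq_square)
    ultimately show ?case by simp
  qed
  have d2: "((\<lambda>e. 2 * e\<^sup>2 * (w e)\<^sup>2) \<longlongrightarrow> 2 * 0\<^sup>2 * c\<^sup>2) (at_right 0)"
    by (intro tendsto_intros id w)
  have "((\<lambda>e. ln (tilted_mgf a e) / e\<^sup>2 - w e) \<longlongrightarrow> 0) (at_right 0)"
    by (rule Lim_null_comparison[OF d1]) (use d2 in simp)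
  from tendsto_add[OF this w] show ?thesis by (simp add: c_def)
qed

lemma tilted_mgf_pos: "tilted_mgf a e > 0"
proof -
  have bd: "\<bar>a * e * score (x - e)\<bar> \<le> \<bar>a * e\<bar> * (1/2)" for x
    unfolding abs_mult by (intro mult_left_mono abs_score_le) auto
  have "(\<integral>x. exp (- (\<bar>a * e\<bar> * (1/2))) \<partial>pvii_law m) \<le> tilted_mgf a e"
  proof (intro integral_mono)
    show "integrable (pvii_law m) (\<lambda>x. exp (a * e * score (x - e)))"
    proof (rule integrable_D_bounded[where C = "exp (\<bar>a * e\<bar> * (1/2))"])
      show "\<bar>exp (a * e * score (x - e))\<bar> \<le> exp (\<bar>a * e\<bar> * (1/2))" for x
        using bd[of x] by (simp add: abs_le_iff)
    qed measurable
    show "exp (- (\<bar>a * e\<bar> * (1/2))) \<le> exp (a * e * score (x - e))" for x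
      using bd[of x] by (simp add: abs_le_iff)
  qed simp
  moreover have "(\<integral>x. exp (- (\<bar>a * e\<bar> * (1/2))) \<partial>pvii_law m) = exp (- (\<bar>a * e\<bar> * (1/2)))"
    by simp
  ultimately show ?thesis
    using exp_gt_zero[of "- (\<bar>a * e\<bar> * (1/2))"] by linarith
qed

text \<open>An n-th power only multiplies the logarithm by \<open>n\<close>, so one neighbourhood of
  \<open>e\<close> serves all \<open>n\<close>. This order of quantifiers is what permits
  \<open>e\<close> to depend on \<open>n\<close> later.\<close>

lemma tilted_mgf_power_bounds:
  assumes "\<delta> > 0"
  shows "\<forall>\<^sub>F e in at_right 0. \<forall>n.
      exp (n * e\<^sup>2 * (V * (a\<^sup>2 / 2 - 2 * m * a) - \<delta>)) \<le> tilted_mgf a e ^ n \<and>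
      tilted_mgf a e ^ n \<le> exp (n * e\<^sup>2 * (V * (a\<^sup>2 / 2 - 2 * m * a) + \<delta>))"
proof -
  define c where "c = V * (a\<^sup>2 / 2 - 2 * m * a)"
  have lim: "((\<lambda>e. ln (tilted_mgf a e) / e\<^sup>2) \<longlongrightarrow> c) (at_right 0)"
    unfolding c_def by (rule ln_tilted_mgf_asymp)
  have pos: "\<forall>\<^sub>F e in at_right 0. (0::real) < e" by (rule eventually_at_right_less)
  have "\<forall>\<^sub>F e in at_right 0. c - \<delta> < ln (tilted_mgf a e) / e\<^sup>2"
       "\<forall>\<^sub>F e in at_right 0. ln (tilted_mgf a e) / e\<^sup>2 < c + \<delta>"
    using order_tendstoD[OF lim] assms by auto
  with pos show ?thesis
    unfolding c_def[symmetric]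
  proof eventually_elim
    case (elim e)
    then have 1: "e\<^sup>2 * (c - \<delta>) \<le> ln (tilted_mgf a e)" "ln (tilted_mgf a e) \<le> e\<^sup>2 * (c + \<delta>)"
      by (auto simp: field_simps)
    show ?case
    proof
      fix n :: nat
      have p: "tilted_mgf a e ^ n = exp (n * ln (tilted_mgf a e))"
        using tilted_mgf_pos[of a e] by (simp add: exp_of_nat_mult)
      show "exp (n * e\<^sup>2 * (c - \<delta>)) \<le> tilted_mgf a e ^ n \<and>
          tilted_mgf a e ^ n \<le> exp (n * e\<^sup>2 * (c + \<delta>))"
        unfolding p using 1 by (simp add: mult.assoc mult_left_mono)
    qed
  qed
qed

lemma prob_score_upper:
  assumes "\<delta> > 0"
  shows "\<forall>\<^sub>F e in at_right 0. \<forall>n.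
    prob {\<omega> \<in> space M. 0 \<le> (\<Sum>i<n. score (Y i \<omega> - e))} \<le> exp (- real n * e\<^sup>2 * (2 * m\<^sup>2 * V - \<delta>))"
  using tilted_mgf_power_bounds[OF assms, of "2 * m"] eventually_at_right_less[of 0]
proof eventually_elim
  case (elim e)
  show ?case
  proof
    fix n :: nat
    let ?g = "\<lambda>x. 2 * m * e * score (x - e)"
    have bd: "\<bar>?g x\<bar> \<le> \<bar>2 * m * e\<bar> * (1/2)" for x
      unfolding abs_mult[of "2 * m * e"] by (intro mult_left_mono abs_score_le) auto
    have "prob {\<omega> \<in> space M. 0 \<le> (\<Sum>i<n. score (Y i \<omega> - e))}
        = prob {\<omega> \<in> space M. 0 \<le> (\<Sum>i<n. ?g (Y i \<omega>))}"
    proof -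
      have "0 < 2 * m * e" using elim(2) m by simp
      then show ?thesis
        by (simp only: sum_distrib_left[symmetric] zero_le_mult_iff less_le_not_le) simp
    qed
    also have "\<dots> \<le> tilted_mgf (2 * m) e ^ n"
      by (rule chernoff_bound[OF _ bd]) measurable
    also have "\<dots> \<le> exp (n * e\<^sup>2 * (V * ((2 * m)\<^sup>2 / 2 - 2 * m * (2 * m)) + \<delta>))"
      using elim by blast
    also have "n * e\<^sup>2 * (V * ((2 * m)\<^sup>2 / 2 - 2 * m * (2 * m)) + \<delta>) = - real n * e\<^sup>2 * (2 * m\<^sup>2 * V - \<delta>)"
      by (simp add: power2_eq_square algebra_simps)
    finally show "prob {\<omega> \<in> space M. 0 \<le> (\<Sum>i<n. score (Y i \<omega> - e))}
        \<le> exp (- real n * e\<^sup>2 * (2 * m\<^sup>2 * V - \<delta>))" .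
  qed
qed

lemma prob_score_lower:
  assumes \<delta>: "\<delta> > 0"
  shows "\<exists>K. \<forall>\<^sub>F e in at_right 0. \<forall>n. K \<le> real n * e\<^sup>2 \<longrightarrow>
    exp (- real n * e\<^sup>2 * (2 * m\<^sup>2 * V + \<delta>)) \<le> prob {\<omega> \<in> space M. 0 < (\<Sum>i<n. score (Y i \<omega> - e))}"
proof -
  have V: "V > 0" by (rule score_var_pos[OF m])
  define J where "J = 2 * m\<^sup>2 * V"
  \<comment> \<open>Removing the exponential weight will cost \<open>2 * V * \<eta> * a\<close> in
    the exponent with a \<le> 2 m + 1; this choice keeps the cost below \<delta> / 2.\<close>
  define \<eta> where "\<eta> = min 1 (\<delta> / (2 * V * (4 * m + 2)))"
  have \<eta>: "\<eta> > 0" "\<eta> \<le> 1" "\<eta> * (2 * V * (4 * m + 2)) \<le> \<delta>"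
  proof -
    have "2 * V * (4 * m + 2) > 0" using V m by simp
    then show "\<eta> > 0" "\<eta> \<le> 1" "\<eta> * (2 * V * (4 * m + 2)) \<le> \<delta>"
      using \<delta> unfolding \<eta>_def by (auto simp: min_le_iff_disj simp flip: pos_le_divide_eq)
  qed
  \<comment> \<open>\<open>\<eta>\<close> is the distance of the tilt from the optimum \<open>2 m\<close>; \<open>4 \<sigma>\<close> is the resulting loss in the
    exponent, so errors of size \<open>\<sigma>\<close> leave the neighbouring tilts negligible.\<close>
  define \<sigma> where "\<sigma> = V * \<eta>\<^sup>2 / 8"
  have \<sigma>: "\<sigma> > 0" using V \<eta> by (simp add: \<sigma>_def)
  \<comment> \<open>The first bound absorbs a factor 1/2 into the remaining \<delta> / 2; the second
    makes each of the two discarded terms at most a quarter of the main one.\<close>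
  define K where "K = max (2 * ln 2 / \<delta>) (ln 4 / (2 * \<sigma>))"
  define a where "a = 2 * m + \<eta>"
  have qa: "V * (a\<^sup>2 / 2 - 2 * m * a) = 4 * \<sigma> - J"
    by (simp add: a_def \<sigma>_def J_def power2_eq_square algebra_simps)
  have qa1: "V * ((a - \<eta>)\<^sup>2 / 2 - 2 * m * (a - \<eta>)) = - J"
    by (simp add: a_def J_def power2_eq_square algebra_simps)
  have qa2: "V * ((a + \<eta>)\<^sup>2 / 2 - 2 * m * (a + \<eta>)) = 16 * \<sigma> - J"
    by (simp add: a_def \<sigma>_def J_def power2_eq_square algebra_simps)
  show ?thesis
  proof (rule exI[of _ K])
    show "\<forall>\<^sub>F e in at_right 0. \<forall>n. K \<le> real n * e\<^sup>2 \<longrightarrow> exp (- real n * e\<^sup>2 * (2 * m\<^sup>2 * V + \<delta>))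
        \<le> prob {\<omega> \<in> space M. 0 < (\<Sum>i<n. score (Y i \<omega> - e))}"
      using tilted_mgf_power_bounds[OF \<sigma>, of a] tilted_mgf_power_bounds[OF \<sigma>, of "a - \<eta>"]
        tilted_mgf_power_bounds[OF \<sigma>, of "a + \<eta>"] eventually_at_right_less[of 0]
      unfolding qa qa1 qa2 J_def[symmetric]
    proof eventually_elim
      case (elim e)
      show ?case
      proof (intro allI impI)
        fix n :: nat assume nK: "K \<le> real n * e\<^sup>2"
        define N where "N = n * e\<^sup>2"
        have N: "2 * ln 2 / \<delta> \<le> N" "ln 4 / (2 * \<sigma>) \<le> N" "N \<ge> 0"
          using nK by (auto simp: N_def K_def)
        let ?P = "prob {\<omega> \<in> space M. 0 < (\<Sum>i<n. score (Y i \<omega> - e))}"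
        let ?Z = "\<lambda>s. \<integral>x. exp (s * score (x - e)) \<partial>pvii_law m"
        have Z: "exp (N * (3 * \<sigma> - J)) \<le> ?Z (a * e) ^ n"
            "?Z (a * e - \<eta> * e) ^ n \<le> exp (N * (\<sigma> - J))"
            "?Z (a * e + \<eta> * e) ^ n \<le> exp (N * (17 * \<sigma> - J))"
          using elim(1-3)[THEN spec, of n] by (auto simp: N_def algebra_simps)
        \<comment> \<open>Under the tilt \<open>a * e\<close> the score has mean about
          \<open>V * \<eta> * e\<close>, the derivative of the quadratic exponent; the cutoff
          \<open>b\<close> is twice that.\<close>
        have "exp (- (a * e) * (2 * V * \<eta> * e) * n) * (?Z (a * e) ^ n - ?Z (a * e - \<eta> * e) ^ n
            - exp (- (\<eta> * e) * (2 * V * \<eta> * e) * n) * ?Z (a * e + \<eta> * e) ^ n) \<le> ?P"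
          using elim(4) m \<eta>(1)
          by (intro tilting_lower_bound[OF _ abs_score_le]) (auto simp: a_def)
        also have "- (a * e) * (2 * V * \<eta> * e) * n = - (2 * V * \<eta> * a) * N"
          by (simp add: N_def power2_eq_square)
        also have "- (\<eta> * e) * (2 * V * \<eta> * e) * n = - 16 * \<sigma> * N"
          by (simp add: N_def \<sigma>_def power2_eq_square)
        finally have P: "exp (- (2 * V * \<eta> * a) * N) * (?Z (a * e) ^ n - ?Z (a * e - \<eta> * e) ^ n
            - exp (- 16 * \<sigma> * N) * ?Z (a * e + \<eta> * e) ^ n) \<le> ?P" .
        \<comment> \<open>The cutoff brings the upper tilt from exponent
          \<open>17 * \<sigma> - J\<close> down to \<open>\<sigma> - J\<close>, the same as for the
          lower tilt.\<close>
        have third: "exp (- 16 * \<sigma> * N) * ?Z (a * e + \<eta> * e) ^ n \<le> exp (N * (\<sigma> - J))"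
        proof -
          have "exp (- 16 * \<sigma> * N) * ?Z (a * e + \<eta> * e) ^ n \<le> exp (- 16 * \<sigma> * N) * exp (N * (17 * \<sigma> - J))"
            by (intro mult_left_mono Z) auto
          also have "\<dots> = exp (N * (\<sigma> - J))" by (simp add: algebra_simps flip: exp_add)
          finally show ?thesis .
        qed
        have half: "exp (N * (3 * \<sigma> - J)) / 2 \<le> exp (N * (3 * \<sigma> - J)) - 2 * exp (N * (\<sigma> - J))"
        proof -
          have "ln 4 \<le> N * (2 * \<sigma>)" using N(2) \<sigma> by (simp add: field_simps)
          then have "exp (- (N * (2 * \<sigma>))) \<le> exp (- ln 4)" by simp
          then have "exp (- (N * (2 * \<sigma>))) \<le> 1 / 4" by (simp add: exp_minus)
          moreover have "exp (N * (\<sigma> - J)) = exp (N * (3 * \<sigma> - J)) * exp (- (N * (2 * \<sigma>)))"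
            by (simp add: algebra_simps flip: exp_add)
          ultimately show ?thesis by simp
        qed
        have "exp (- N * (J + \<delta>)) \<le> exp (- (2 * V * \<eta> * a) * N) * (exp (N * (3 * \<sigma> - J)) / 2)"
        proof -
          have "ln 2 \<le> N * (\<delta> / 2)" using N(1) \<delta> by (simp add: field_simps)
          moreover have "2 * V * \<eta> * a \<le> \<delta> / 2"
          proof -
            have "2 * V * \<eta> * a = \<eta> * (2 * V * (2 * m + \<eta>))" by (simp add: a_def)
            also have "\<dots> \<le> \<eta> * (V * (4 * m + 2))"
              using \<eta> V by (intro mult_left_mono) (auto simp: algebra_simps)
            finally show ?thesis using \<eta>(3) by simp
          qed
          then have "N * (2 * V * \<eta> * a) \<le> N * (\<delta> / 2)" using N by (intro mult_left_mono) auto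
          moreover have "0 \<le> N * (3 * \<sigma>)" using N \<sigma> by simp
          ultimately have "- N * (J + \<delta>) \<le> - (2 * V * \<eta> * a) * N + N * (3 * \<sigma> - J) - ln 2"
            by (simp add: algebra_simps)
          then have "exp (- N * (J + \<delta>)) \<le> exp (- (2 * V * \<eta> * a) * N + N * (3 * \<sigma> - J) - ln 2)"
            by simp
          also have "\<dots> = exp (- (2 * V * \<eta> * a) * N) * (exp (N * (3 * \<sigma> - J)) / 2)"
            unfolding exp_diff exp_add by (simp only: times_divide_eq_right) simp
          finally show ?thesis .
        qed
        also have "\<dots> \<le> exp (- (2 * V * \<eta> * a) * N) * (?Z (a * e) ^ n - ?Z (a * e - \<eta> * e) ^ n
            - exp (- 16 * \<sigma> * N) * ?Z (a * e + \<eta> * e) ^ n)"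
          using half third Z by (intro mult_left_mono) auto
        also have "\<dots> \<le> ?P" by (rule P)
        finally show "exp (- real n * e\<^sup>2 * (J + \<delta>)) \<le> ?P" by (simp add: N_def)
      qed
    qed
  qed
qed

end

section \<open>Exponential consistency and strict monotonicity of the score\<close>

lemma ln_ratio_bound:
  "\<bar>ln (1 + (x - t)\<^sup>2) - ln (1 + x\<^sup>2)\<bar> \<le> \<bar>t\<bar>" for x t :: real
  using ln_one_plus_square_lipschitz[of x t 0] by simp

context iid_sample
begin

text \<open>The rate \<open>c\<close> is fixed for the whole sequence; measurability is included so
  that unions can be estimated.\<close>

definition exp_negligible :: "(nat \<Rightarrow> 'a set) \<Rightarrow> bool" where
  "exp_negligible A \<longleftrightarrow> (\<forall>n. A n \<in> events) \<and>
    (\<exists>K\<ge>0. \<exists>c>0. \<forall>n. prob (A n) \<le> K * exp (- c * real n))"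

lemma exp_negligible_empty: "exp_negligible (\<lambda>n. {})"
  unfolding exp_negligible_def by (intro conjI exI[of _ 0] exI[of _ 1]) auto

lemma exp_negligible_Un:
  assumes "exp_negligible A" "exp_negligible B"
  shows "exp_negligible (\<lambda>n. A n \<union> B n)"
proof -
  from assms obtain K c K' c' where *: "K \<ge> 0" "c > 0" "K' \<ge> 0" "c' > 0"
    "\<And>n. prob (A n) \<le> K * exp (- c * real n)" "\<And>n. prob (B n) \<le> K' * exp (- c' * real n)"
    and ev: "\<And>n. A n \<in> events" "\<And>n. B n \<in> events"
    unfolding exp_negligible_def by blast
  have "prob (A n \<union> B n) \<le> (K + K') * exp (- min c c' * real n)" for n
  proof -
    have "prob (A n \<union> B n) \<le> prob (A n) + prob (B n)"
      by (intro measure_Un_le ev)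
    also have "\<dots> \<le> K * exp (- c * real n) + K' * exp (- c' * real n)"
      using * by (intro add_mono) auto
    also have "\<dots> \<le> K * exp (- min c c' * real n) + K' * exp (- min c c' * real n)"
      using * by (intro add_mono mult_left_mono) (auto intro!: mult_right_mono)
    finally show ?thesis by (simp add: algebra_simps)
  qed
  then show ?thesis
    unfolding exp_negligible_def using * ev
    by (intro conjI exI[of _ "K + K'"] exI[of _ "min c c'"]) auto
qed

lemma exp_negligible_UN:
  assumes "finite T" "\<And>t. t \<in> T \<Longrightarrow> exp_negligible (A t)"
  shows "exp_negligible (\<lambda>n. \<Union>t\<in>T. A t n)"
  using assms
proof (induction T rule: finite_induct)
  case empty
  then show ?case using exp_negligible_empty by simp
next
  case (insert t T)
  then show ?case using exp_negligible_Un[of "A t" "\<lambda>n. \<Union>t\<in>T. A t n"] by simp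
qed

lemma exp_negligible_sum:
  assumes g [measurable]: "g \<in> borel_measurable borel" and bd: "\<And>x. \<bar>g x\<bar> \<le> (C::real)"
    and neg: "integral\<^sup>L D g < 0"
  shows "exp_negligible (\<lambda>n. {\<omega> \<in> space M. 0 \<le> (\<Sum>i<n. g (Y i \<omega>))})"
proof -
  obtain q where q: "0 < q" "q < 1" "\<And>n. prob {\<omega> \<in> space M. 0 \<le> (\<Sum>i<n. g (Y i \<omega>))} \<le> q ^ n"
    using exponential_decay[OF g bd neg] by blast
  have "q ^ n = 1 * exp (- (- ln q) * real n)" for n
    using q by (simp add: exp_of_nat2_mult)
  with q show ?thesis
    unfolding exp_negligible_def
    by (intro conjI exI[of _ 1] exI[of _ "- ln q"]) auto
qed

lemma small_tail: "\<delta> > 0 \<Longrightarrow> \<exists>B>0. measure D {x. B < \<bar>x\<bar>} < \<delta>"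
proof -
  interpret D: prob_space D by (rule prob_space_D)
  assume "\<delta> > 0"
  have "(\<lambda>k. measure D {x. real k < \<bar>x\<bar>}) \<longlonglongrightarrow> measure D (\<Inter>k. {x. real k < \<bar>x\<bar>})"
    by (rule D.finite_Lim_measure_decseq) (auto simp: decseq_def intro: le_less_trans)
  moreover have "(\<Inter>k. {x. real k < \<bar>x\<bar>}) = {}"
  proof -
    have "\<exists>k. \<bar>x\<bar> \<le> real k" for x :: real
      using reals_Archimedean2[of "\<bar>x\<bar>"] less_imp_le by blast
    then show ?thesis by (simp add: not_less set_eq_iff)
  qed
  ultimately have "(\<lambda>k. measure D {x. real k < \<bar>x\<bar>}) \<longlonglongrightarrow> 0" by simp
  then have "\<forall>\<^sub>F k in sequentially. measure D {x. real k < \<bar>x\<bar>} < \<delta>"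
    using \<open>\<delta> > 0\<close> by (rule order_tendstoD)
  then have "\<forall>\<^sub>F k in sequentially. 0 < k \<and> measure D {x. real k < \<bar>x\<bar>} < \<delta>"
    using eventually_gt_at_top[of 0] by eventually_elim auto
  then obtain k :: nat where "0 < k" "measure D {x. real k < \<bar>x\<bar>} < \<delta>"
    using eventually_happens'[OF sequentially_bot] by blast
  then show ?thesis by (intro exI[of _ "real k"]) auto
qed

end

context pvii_sample
begin

text \<open>
  Up to the factor \<open>m\<close> this is the Kullback--Leibler divergence between the law and its shift by \<open>t\<close>.
\<close>

lemma expected_ln_ratio_pos:
  assumes t: "t \<noteq> 0"
  shows "0 < (\<integral>x. ln (1 + (x - t)\<^sup>2) - ln (1 + x\<^sup>2) \<partial>pvii_law m)"
proof -
  let ?h = "\<lambda>x. ln (1 + (x - t)\<^sup>2) - ln (1 + x\<^sup>2)"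
  let ?f = "pvii_f m"
  \<comment> \<open>The first two terms integrate to 0 together, so the integral of \<open>g\<close>
    is \<open>m\<close> times the claimed one. Pointwise, \<open>g\<close> is the density times exp
    y - 1 - y with \<open>y = - m * ?h x\<close>, hence nonnegative, and it is positive at
    0.\<close>
  define g where "g = (\<lambda>x. ?f (x - t) - ?f x + m * (?f x * ?h x))"
  have ratio: "?f (x - t) = ?f x * exp (- m * ?h x)" for x
    unfolding pvii_f_def powr_def by (simp add: algebra_simps flip: exp_add)
  have g: "g x = ?f x * (exp (- m * ?h x) - 1 - (- m * ?h x))" for x
    unfolding g_def ratio by (simp add: algebra_simps)
  have exp_strict: "0 < exp y - 1 - y" if "y \<noteq> 0" for y :: real
  proof -
    have "1 + y \<noteq> exp y"
    proof
      assume "1 + y = exp y"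
      then have "ln (exp y) = exp y - 1" unfolding ln_exp by linarith
      then have "exp y = 1" by (intro ln_eq_minus_one) auto
      with that show False by simp
    qed
    then have "1 + y < exp y" using exp_ge_add_one_self[of y] by (rule order_le_neq_trans[rotated])
    then show ?thesis by simp
  qed
  have i1: "integrable lborel (\<lambda>x. ?f (x - t))"
    using lborel_integrable_real_affine[OF integrable_pvii_f[OF m], of 1 "-t"] by simp
  have i2: "integrable lborel ?f" by (rule integrable_pvii_f[OF m])
  have i3: "integrable lborel (\<lambda>x. ?f x * ?h x)"
    using integrable_D_bounded[of ?h, OF _ ln_ratio_bound]
    by (subst integrable_pvii_law_iff[OF m, symmetric]) auto
  have "0 < integral\<^sup>L lborel g"
  proof (rule integral_lborel_pos[where a = 0])
    show "integrable lborel g"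
      unfolding g_def by (intro Bochner_Integration.integrable_add
          Bochner_Integration.integrable_diff integrable_mult_right i1 i2 i3)
    show "continuous_on UNIV g"
      unfolding g_def by (intro continuous_intros) auto
    show "0 \<le> g x" for x
      unfolding g using pvii_f_nonneg[OF m, of x] exp_ge_add_one_self[of "- m * ?h x"]
      by (intro mult_nonneg_nonneg) linarith+
    have "- m * ?h 0 \<noteq> 0" using t m by simp
    from exp_strict[OF this] show "0 < g 0"
      unfolding g by (intro mult_pos_pos pvii_f_pos[OF m])
  qed
  also have "integral\<^sup>L lborel g = (\<integral>x. ?f (x - t) \<partial>lborel) - integral\<^sup>L lborel ?f
      + m * (\<integral>x. ?f x * ?h x \<partial>lborel)"
    unfolding g_def using i1 i2 i3 by simp
  also have "(\<integral>x. ?f (x - t) \<partial>lborel) = integral\<^sup>L lborel ?f"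
    using lborel_integral_real_affine[of 1 ?f "-t"] by simp
  also have "(\<integral>x. ?f x * ?h x \<partial>lborel) = (\<integral>x. ?h x \<partial>pvii_law m)"
    by (subst integral_pvii_law[OF m]) auto
  finally show ?thesis using m by (simp add: zero_less_mult_iff)
qed

text \<open>The parameter line is split in three: near 0 the mean of \<open>dscore\<close> gives
  curvature, on a compact annulus a finite cover and positive divergence exclude minimizers of the
  log sum, and far out the logarithmic growth does, provided few observations are outliers.\<close>

lemma likelihood_good_event:
  "\<exists>r>0. \<exists>Bad. exp_negligible Bad \<and> (\<forall>n. \<forall>\<omega>\<in>space M - Bad n.
    (\<forall>t. r < \<bar>t\<bar> \<longrightarrow> (\<Sum>i<n. ln (1 + (Y i \<omega>)\<^sup>2)) < (\<Sum>i<n. ln (1 + (Y i \<omega> - t)\<^sup>2))) \<and>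
    (\<forall>t. \<bar>t\<bar> \<le> r \<longrightarrow> 0 < (\<Sum>i<n. dscore (Y i \<omega> - t))))"
proof -
  define \<kappa> where "\<kappa> = 2 * m * V"
  have \<kappa>: "\<kappa> > 0" using m score_var_pos[OF m] by (simp add: \<kappa>_def)
  \<comment> \<open>A shift by at most \<open>r\<close> changes \<open>dscore\<close> by at most
    \<open>6 * r\<close>, half of its mean \<kappa>.\<close>
  define r where "r = \<kappa> / 12"
  have r: "r > 0" using \<kappa> by (simp add: r_def)
  let ?h = "\<lambda>t x. ln (1 + (x - t)\<^sup>2) - ln (1 + x\<^sup>2)"

  define A1 where "A1 = (\<lambda>n. {\<omega> \<in> space M. 0 \<le> (\<Sum>i<n. \<kappa> / 2 - dscore (Y i \<omega>))})"
  have A1: "exp_negligible A1"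
    unfolding A1_def
  proof (rule exp_negligible_sum[where C = "\<kappa> / 2 + 1" and g = "\<lambda>x. \<kappa> / 2 - dscore x"])
    show "\<bar>\<kappa> / 2 - dscore x\<bar> \<le> \<kappa> / 2 + 1" for x
      using abs_dscore_le[of x] \<kappa> by linarith
    have "integrable (pvii_law m) dscore"
      by (rule integrable_D_bounded[OF _ abs_dscore_le]) measurable
    then show "(\<integral>x. \<kappa> / 2 - dscore x \<partial>pvii_law m) < 0"
      using \<kappa> by (simp add: integral_dscore[OF m] \<kappa>_def)
  qed measurable

  \<comment> \<open>An outlier share below 3/8 leaves at least 1 - 2 * 3/8 = 1/4 of the growth
    \<open>l\<close> in the average over the sample.\<close>
  obtain B where B: "B > 0" "measure (pvii_law m) {x. B < \<bar>x\<bar>} < 3 / 8"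
    using small_tail[of "3/8"] by auto
  let ?out = "\<lambda>x. indicator {x. B < \<bar>x\<bar>} x :: real"
  define A2 where "A2 = (\<lambda>n. {\<omega> \<in> space M. 0 \<le> (\<Sum>i<n. ?out (Y i \<omega>) - 3 / 8)})"
  have A2: "exp_negligible A2"
    unfolding A2_def
  proof (rule exp_negligible_sum[where C = 1 and g = "\<lambda>x. ?out x - 3 / 8"])
    show "\<bar>?out x - 3 / 8\<bar> \<le> 1" for x by (simp add: indicator_def)
    have "integrable (pvii_law m) ?out"
      by (rule integrable_D_bounded[where C = 1]) (auto simp: indicator_def)
    then have "(\<integral>x. ?out x - 3 / 8 \<partial>pvii_law m) = measure (pvii_law m) {x. B < \<bar>x\<bar>} - 3 / 8"
      by simp
    with B show "(\<integral>x. ?out x - 3 / 8 \<partial>pvii_law m) < 0" by simp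
  qed measurable

  \<comment> \<open>\<open>ln (1 + B\<^sup>2)\<close> bounds the subtracted term when |x| \<le> B,
    and \<open>ln 4\<close> comes from |x - t| \<ge> |t| / 2.\<close>
  define c where "c = ln 4 + ln (1 + B\<^sup>2)"
  have c: "c \<ge> 0" by (simp add: c_def)
  \<comment> \<open>Beyond \<open>2 * B\<close> one has |x - t| \<ge> |t| / 2 for |x| \<le> B;
    beyond \<open>exp (2 * c)\<close> the growth \<open>l\<close> exceeds
    \<open>4 * c\<close>.\<close>
  define R where "R = max (2 * B) (exp (2 * c))"
  \<comment> \<open>Half of the divergence is the margin for the exponential bound at a centre of
    the cover; the other half pays, through the Lipschitz constant 1, for moving within the ball of
    radius \<open>d t\<close>.\<close>
  define d where "d = (\<lambda>t. (\<integral>x. ?h t x \<partial>pvii_law m) / 2)"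
  have d: "d t > 0" if "t \<noteq> 0" for t
    using expected_ln_ratio_pos[OF that] by (simp add: d_def)
  define S where "S = {t. r \<le> \<bar>t\<bar> \<and> \<bar>t\<bar> \<le> R}"
  have "compact S"
    unfolding compact_eq_bounded_closed
  proof
    show "bounded S" by (rule boundedI[of _ R]) (auto simp: S_def)
    show "closed S" unfolding S_def by (intro closed_Collect_conj closed_Collect_le continuous_intros)
  qed
  moreover have "S \<subseteq> (\<Union>t\<in>S. ball t (d t))"
  proof
    fix t assume "t \<in> S"
    then have "t \<noteq> 0" using r by (auto simp: S_def)
    then have "t \<in> ball t (d t)" using d by simp
    with \<open>t \<in> S\<close> show "t \<in> (\<Union>t\<in>S. ball t (d t))" by blast
  qed
  ultimately obtain T where T: "T \<subseteq> S" "finite T" "S \<subseteq> (\<Union>t\<in>T. ball t (d t))"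
    using compactE_image[of S S "\<lambda>t. ball t (d t)"] by (metis open_ball)
  define A3 where "A3 = (\<lambda>n. \<Union>t\<in>T. {\<omega> \<in> space M. 0 \<le> (\<Sum>i<n. d t - ?h t (Y i \<omega>))})"
  have A3: "exp_negligible A3"
    unfolding A3_def
  proof (rule exp_negligible_UN[OF T(2)])
    fix t assume "t \<in> T"
    then have t: "t \<noteq> 0" using T(1) r by (auto simp: S_def)
    show "exp_negligible (\<lambda>n. {\<omega> \<in> space M. 0 \<le> (\<Sum>i<n. d t - ?h t (Y i \<omega>))})"
    proof (rule exp_negligible_sum[where C = "d t + \<bar>t\<bar>" and g = "\<lambda>x. d t - ?h t x"])
      show "\<bar>d t - ?h t x\<bar> \<le> d t + \<bar>t\<bar>" for x
        using ln_ratio_bound[of x t] d[OF t] by linarith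
      have "integrable (pvii_law m) (?h t)"
        by (rule integrable_D_bounded[OF _ ln_ratio_bound]) measurable
      then have "(\<integral>x. d t - ?h t x \<partial>pvii_law m) = d t - (\<integral>x. ?h t x \<partial>pvii_law m)"
        by (subst Bochner_Integration.integral_diff) auto
      also have "\<dots> = - d t" by (simp add: d_def)
      finally show "(\<integral>x. d t - ?h t x \<partial>pvii_law m) < 0" using d[OF t] by simp
    qed measurable
  qed

  \<comment> \<open>For large \<open>t\<close> an observation in \<open>[-B, B]\<close> contributes about \<open>ln (1 + t\<^sup>2)\<close> and any other at least about
    \<open>- ln (1 + t\<^sup>2)\<close>; less than \<open>3/8\<close> of the observations are of the second kind.\<close>
  have far: "0 < (\<Sum>i<n. ?h t (Y i \<omega>))"
    if \<omega>: "\<omega> \<in> space M - A2 n" and t: "R < \<bar>t\<bar>" for n \<omega> t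
  proof -
    define l where "l = ln (1 + t\<^sup>2)"
    have tB: "2 * B < \<bar>t\<bar>" and tc: "exp (2 * c) < \<bar>t\<bar>" using t by (auto simp: R_def)
    have t0: "0 < \<bar>t\<bar>" using tB B by linarith
    have "4 * c < ln (t\<^sup>2)"
    proof -
      have "ln (exp (2 * c)) < ln \<bar>t\<bar>" using tc t0 by (subst ln_less_cancel_iff) auto
      moreover have "ln (t\<^sup>2) = 2 * ln \<bar>t\<bar>" using t0 ln_realpow[of "\<bar>t\<bar>" 2] by simp
      ultimately show ?thesis by simp
    qed
    also have "\<dots> \<le> l" unfolding l_def using t0 by (subst ln_le_cancel_iff) auto
    finally have l: "4 * c < l" .
    have h: "l - c - 2 * l * ?out x \<le> ?h t x" for x
    proof (cases "B < \<bar>x\<bar>")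
      case True
      have "1 + x\<^sup>2 \<le> 2 * ((1 + (x - t)\<^sup>2) * (1 + t\<^sup>2))"
      proof -
        have 1: "x\<^sup>2 \<le> 2 * (x - t)\<^sup>2 + 2 * t\<^sup>2"
          using zero_le_power2[of "x - 2 * t"] by (simp add: power2_eq_square algebra_simps)
        have 2: "0 \<le> (x - t)\<^sup>2 * t\<^sup>2" by simp
        have "2 * ((1 + (x - t)\<^sup>2) * (1 + t\<^sup>2))
            = 2 + 2 * (x - t)\<^sup>2 + 2 * t\<^sup>2 + 2 * ((x - t)\<^sup>2 * t\<^sup>2)"
          by (simp add: algebra_simps)
        with 1 2 show ?thesis by linarith
      qed
      then have "ln (1 + x\<^sup>2) \<le> ln (2 * ((1 + (x - t)\<^sup>2) * (1 + t\<^sup>2)))"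
        by (subst ln_le_cancel_iff) auto
      also have "\<dots> = ln 2 + ln (1 + (x - t)\<^sup>2) + l"
        by (simp add: ln_mult l_def)
      finally have "ln (1 + x\<^sup>2) \<le> ln 2 + ln (1 + (x - t)\<^sup>2) + l" .
      moreover have "ln 2 \<le> c"
      proof -
        have "ln 2 \<le> (ln 4 :: real)" by simp
        also have "\<dots> \<le> c" by (simp add: c_def)
        finally show ?thesis .
      qed
      ultimately show ?thesis using True by simp
    next
      case False
      then have x: "\<bar>x\<bar> \<le> B" by simp
      have "\<bar>t\<bar> / 2 \<le> \<bar>x - t\<bar>" using x tB by linarith
      then have "(\<bar>t\<bar> / 2)\<^sup>2 \<le> \<bar>x - t\<bar>\<^sup>2" by (rule power_mono) simp
      then have "1 + t\<^sup>2 \<le> 4 * (1 + (x - t)\<^sup>2)" by (simp add: power_divide)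
      then have "l \<le> ln (4 * (1 + (x - t)\<^sup>2))"
        unfolding l_def by (subst ln_le_cancel_iff) (auto simp: add_pos_nonneg)
      also have "\<dots> = ln 4 + ln (1 + (x - t)\<^sup>2)" by (rule ln_mult_pos) auto
      finally have 1: "l \<le> ln 4 + ln (1 + (x - t)\<^sup>2)" .
      have 2: "ln (1 + x\<^sup>2) \<le> ln (1 + B\<^sup>2)"
        using power_mono[OF x, of 2] by (subst ln_le_cancel_iff) auto
      have "2 * l * ?out x = 0" using x by simp
      with 1 2 show ?thesis unfolding c_def by linarith
    qed
    \<comment> \<open>The case n = 0 cannot occur: the empty sum puts the whole space into
      \<open>A2 0\<close>.\<close>
    have "(\<Sum>i<n. ?out (Y i \<omega>) - 3 / 8) < 0" using \<omega> by (auto simp: A2_def)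
    then have out: "(\<Sum>i<n. ?out (Y i \<omega>)) < n * (3 / 8)" by (simp add: sum_subtractf)
    have "0 \<le> n * (l / 4 - c)" using l by simp
    also have "\<dots> = n * (l - c) - 2 * l * (n * (3 / 8))" by (simp add: algebra_simps)
    also have "\<dots> < n * (l - c) - 2 * l * (\<Sum>i<n. ?out (Y i \<omega>))"
      using out l c by simp
    also have "\<dots> = (\<Sum>i<n. l - c - 2 * l * ?out (Y i \<omega>))"
      by (simp add: sum_subtractf sum_distrib_left)
    also have "\<dots> \<le> (\<Sum>i<n. ?h t (Y i \<omega>))" by (intro sum_mono h)
    finally show ?thesis .
  qed

  have mid: "0 < (\<Sum>i<n. ?h t (Y i \<omega>))"
    if \<omega>: "\<omega> \<in> space M - A3 n" and t: "t \<in> S" for n \<omega> t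
  proof -
    obtain t' where t': "t' \<in> T" "\<bar>t' - t\<bar> < d t'"
      using T(3) t by (auto simp: dist_real_def)
    have "(\<Sum>i<n. d t' - ?h t' (Y i \<omega>)) < 0" using \<omega> t' by (auto simp: A3_def not_le)
    then have "n * d t' < (\<Sum>i<n. ?h t' (Y i \<omega>))" by (simp add: sum_subtractf)
    also have "\<dots> \<le> (\<Sum>i<n. ?h t (Y i \<omega>) + d t')"
    proof (intro sum_mono)
      fix i
      show "?h t' (Y i \<omega>) \<le> ?h t (Y i \<omega>) + d t'"
        using ln_one_plus_square_lipschitz[of "Y i \<omega>" t' t] t'(2) by linarith
    qed
    finally show ?thesis by (simp add: sum.distrib)
  qed

  have near: "0 < (\<Sum>i<n. dscore (Y i \<omega> - t))"
    if \<omega>: "\<omega> \<in> space M - A1 n" and t: "\<bar>t\<bar> \<le> r" for n \<omega> t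
  proof -
    have 1: "(\<Sum>i<n. \<kappa> / 2 - dscore (Y i \<omega>)) < 0" using \<omega> by (auto simp: A1_def)
    have 2: "(\<Sum>i<n. - dscore (Y i \<omega> - t)) \<le> (\<Sum>i<n. \<kappa> / 2 - dscore (Y i \<omega>))"
    proof (intro sum_mono)
      fix i
      show "- dscore (Y i \<omega> - t) \<le> \<kappa> / 2 - dscore (Y i \<omega>)"
        using dscore_lipschitz[of "Y i \<omega>" "Y i \<omega> - t"] t by (simp add: r_def)
    qed
    from order_le_less_trans[OF 2 1] show ?thesis by (simp add: sum_negf)
  qed

  define Bad where "Bad = (\<lambda>n. (A1 n \<union> A2 n) \<union> A3 n)"
  have "exp_negligible Bad"
    unfolding Bad_def by (intro exp_negligible_Un A1 A2 A3)
  moreover have "(\<Sum>i<n. ln (1 + (Y i \<omega>)\<^sup>2)) < (\<Sum>i<n. ln (1 + (Y i \<omega> - t)\<^sup>2))"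
    if "\<omega> \<in> space M - Bad n" "r < \<bar>t\<bar>" for n \<omega> t
  proof -
    have "0 < (\<Sum>i<n. ?h t (Y i \<omega>))"
      using far[of \<omega> n t] mid[of \<omega> n t] that by (cases "R < \<bar>t\<bar>") (auto simp: Bad_def S_def)
    then show ?thesis by (simp add: sum_subtractf)
  qed
  moreover have "0 < (\<Sum>i<n. dscore (Y i \<omega> - t))"
    if "\<omega> \<in> space M - Bad n" "\<bar>t\<bar> \<le> r" for n \<omega> t
    using near[of \<omega> n t] that by (auto simp: Bad_def)
  ultimately show ?thesis using r by blast
qed

end

section \<open>Deviation bounds for the estimator\<close>

text \<open>Comparison with t = 0 confines the minimizer to [-r, r], where it is a zero of a
  strictly decreasing score sum. As \<open>e\<close> may be negative, both tails are
  covered.\<close>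

lemma minimizer_gt_iff:
  fixes y :: "nat \<Rightarrow> real"
  assumes min: "\<And>t. (\<Sum>i<n. ln (1 + (y i - T)\<^sup>2)) \<le> (\<Sum>i<n. ln (1 + (y i - t)\<^sup>2))"
    and far: "\<And>t. r < \<bar>t\<bar> \<Longrightarrow> (\<Sum>i<n. ln (1 + (y i)\<^sup>2)) < (\<Sum>i<n. ln (1 + (y i - t)\<^sup>2))"
    and curv: "\<And>t. \<bar>t\<bar> \<le> r \<Longrightarrow> 0 < (\<Sum>i<n. dscore (y i - t))"
    and e: "\<bar>e\<bar> \<le> r"
  shows "e < T \<longleftrightarrow> 0 < (\<Sum>i<n. score (y i - e))"
proof -
  let ?S = "\<lambda>t. \<Sum>i<n. score (y i - t)"
  have T: "\<bar>T\<bar> \<le> r"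
    using min[of 0] far[of T] by (cases "r < \<bar>T\<bar>") auto
  have "((\<lambda>t. \<Sum>i<n. ln (1 + (y i - t)\<^sup>2)) has_real_derivative (\<Sum>i<n. - 2 * score (y i - T))) (at T)"
    by (intro DERIV_sum ln_one_plus_square_has_derivative)
  then have "(\<Sum>i<n. - 2 * score (y i - T)) = 0"
    by (rule DERIV_local_min[where d = 1]) (use min in auto)
  then have S0: "?S T = 0" by (simp only: sum_distrib_left[symmetric])
  have dS: "(?S has_real_derivative - (\<Sum>i<n. dscore (y i - t))) (at t)" for t
    unfolding sum_negf[symmetric]
  proof (intro DERIV_sum)
    fix i
    have "((\<lambda>t. score (y i - t)) has_real_derivative dscore (y i - t) * (-1)) (at t)"
      by (rule DERIV_chain2[OF has_derivative_score]) (rule derivative_eq_intros refl | simp)+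
    then show "((\<lambda>t. score (y i - t)) has_real_derivative - dscore (y i - t)) (at t)"
      by simp
  qed
  have dec: "?S b < ?S a" if "a < b" "\<bar>a\<bar> \<le> r" "\<bar>b\<bar> \<le> r" for a b
  proof (rule DERIV_neg_imp_decreasing[OF that(1)])
    fix t assume "a \<le> t" "t \<le> b"
    then have "\<bar>t\<bar> \<le> r" using that by linarith
    with dS[of t] curv[of t] show "\<exists>z. (?S has_real_derivative z) (at t) \<and> z < 0"
      by (intro exI[of _ "- (\<Sum>i<n. dscore (y i - t))"]) simp
  qed
  show ?thesis
    using dec[of e T] dec[of T e] e T S0 by (cases e T rule: linorder_cases) auto
qed

context pvii_sample
begin

text \<open>Reflection turns left deviations of the estimator into right ones.\<close>

lemma pvii_sample_uminus: "pvii_sample M m (\<lambda>i \<omega>. - Y i \<omega>)"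
proof
  show "indep_vars (\<lambda>_. borel) (\<lambda>i \<omega>. - Y i \<omega>) UNIV"
    by (rule indep_vars_compose2[OF indep]) measurable
  have "distr M borel (\<lambda>\<omega>. - Y i \<omega>) = distr (distr M borel (Y i)) borel uminus" for i
    by (subst distr_distr) (auto simp: comp_def)
  then show "distr M borel (\<lambda>\<omega>. - Y i \<omega>) = pvii_law m" for i
    by (simp add: distr_Y distr_pvii_law_uminus[OF m])
qed (rule m)

context
  fixes T :: "nat \<Rightarrow> 'a \<Rightarrow> real"
  assumes T_meas [measurable]: "T n \<in> borel_measurable M"
    and T_min: "\<omega> \<in> space M \<Longrightarrow>
      (\<Sum>i<n. ln (1 + (Y i \<omega> - T n \<omega>)\<^sup>2)) \<le> (\<Sum>i<n. ln (1 + (Y i \<omega> - t)\<^sup>2))"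
begin

text \<open>\<open>Bad\<close> does not depend on the threshold \<open>e\<close>, so one negligible
  sequence serves all small deviations.\<close>

lemma minimizer_events:
  "\<exists>r>0. \<exists>Bad. exp_negligible Bad \<and> (\<forall>n. \<forall>\<omega>\<in>space M - Bad n. \<forall>e. \<bar>e\<bar> \<le> r \<longrightarrow>
    (e < T n \<omega> \<longleftrightarrow> 0 < (\<Sum>i<n. score (Y i \<omega> - e))))"
proof -
  obtain r Bad where rB: "r > 0" "exp_negligible Bad"
    and good: "\<And>n \<omega>. \<omega> \<in> space M - Bad n \<Longrightarrow>
      (\<forall>t. r < \<bar>t\<bar> \<longrightarrow> (\<Sum>i<n. ln (1 + (Y i \<omega>)\<^sup>2)) < (\<Sum>i<n. ln (1 + (Y i \<omega> - t)\<^sup>2))) \<and>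
      (\<forall>t. \<bar>t\<bar> \<le> r \<longrightarrow> 0 < (\<Sum>i<n. dscore (Y i \<omega> - t)))"
    using likelihood_good_event by blast
  have "e < T n \<omega> \<longleftrightarrow> 0 < (\<Sum>i<n. score (Y i \<omega> - e))"
    if \<omega>: "\<omega> \<in> space M - Bad n" and e: "\<bar>e\<bar> \<le> r" for n \<omega> e
  proof (rule minimizer_gt_iff[where r = r and y = "\<lambda>i. Y i \<omega>"])
    show "(\<Sum>i<n. ln (1 + (Y i \<omega> - T n \<omega>)\<^sup>2)) \<le> (\<Sum>i<n. ln (1 + (Y i \<omega> - t)\<^sup>2))" for t
      by (rule T_min) (use \<omega> in simp)
  qed (use good[OF \<omega>] e in simp_all)
  with rB show ?thesis by blast
qed

lemma prob_minimizer_upper: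
  assumes \<delta>: "\<delta> > 0"
  shows "\<exists>K>0. \<forall>\<^sub>F e in at_right 0. \<forall>n.
    prob {\<omega> \<in> space M. e < \<bar>T n \<omega>\<bar>} \<le> K * exp (- real n * e\<^sup>2 * (2 * m\<^sup>2 * V - \<delta>))"
proof -
  interpret neg: pvii_sample M m "\<lambda>i \<omega>. - Y i \<omega>" by (rule pvii_sample_uminus)
  obtain r Bad where r: "0 < r" and Bad: "exp_negligible Bad" and good:
    "\<And>n \<omega> e. \<omega> \<in> space M - Bad n \<Longrightarrow> \<bar>e\<bar> \<le> r \<Longrightarrow> e < T n \<omega> \<longleftrightarrow> 0 < (\<Sum>i<n. score (Y i \<omega> - e))"
    using minimizer_events by blast
  from Bad obtain K c where K: "K \<ge> 0" "c > 0"
    and PB: "\<And>n. Bad n \<in> events" "\<And>n. prob (Bad n) \<le> K * exp (- c * real n)"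
    unfolding exp_negligible_def by blast
  define J where "J = 2 * m\<^sup>2 * V - \<delta>"
  have "((\<lambda>e. e\<^sup>2 * J) \<longlongrightarrow> 0\<^sup>2 * J) (at_right 0)" by (intro tendsto_intros)
  then have small: "\<forall>\<^sub>F e in at_right 0. e\<^sup>2 * J < c"
    by (rule order_tendstoD) (use K in simp)
  have er: "\<forall>\<^sub>F e in at_right 0. e \<in> {0<..<r}" by (rule eventually_at_right_real[OF r])
  show ?thesis
  \<comment> \<open>One unit for each of the two score events, and \<open>K\<close> for the
    exceptional event.\<close>
  proof (intro exI[of _ "K + 2"] conjI)
    show "\<forall>\<^sub>F e in at_right 0. \<forall>n. prob {\<omega> \<in> space M. e < \<bar>T n \<omega>\<bar>}
        \<le> (K + 2) * exp (- real n * e\<^sup>2 * (2 * m\<^sup>2 * V - \<delta>))"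
      using prob_score_upper[OF \<delta>] neg.prob_score_upper[OF \<delta>] small er
      unfolding J_def[symmetric]
    proof eventually_elim
      case (elim e)
      show ?case
      proof
        fix n
        let ?A = "{\<omega> \<in> space M. 0 \<le> (\<Sum>i<n. score (Y i \<omega> - e))}"
        let ?B = "{\<omega> \<in> space M. 0 \<le> (\<Sum>i<n. score (- Y i \<omega> - e))}"
        have "{\<omega> \<in> space M. e < \<bar>T n \<omega>\<bar>} \<subseteq> (?A \<union> ?B) \<union> Bad n"
        proof (intro subsetI)
          fix \<omega> assume "\<omega> \<in> {\<omega> \<in> space M. e < \<bar>T n \<omega>\<bar>}"
          then have \<omega>: "\<omega> \<in> space M" and "e < T n \<omega> \<or> T n \<omega> < - e" by auto
          moreover have "\<omega> \<in> ?A" if "e < T n \<omega>" "\<omega> \<notin> Bad n"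
            using good[of \<omega> n e] that \<omega> elim(4) by auto
          moreover have "\<omega> \<in> ?B" if "T n \<omega> < - e" "\<omega> \<notin> Bad n"
          proof -
            have "\<not> 0 < (\<Sum>i<n. score (Y i \<omega> - (- e)))"
              using good[of \<omega> n "- e"] that \<omega> elim(4) by auto
            moreover have "score (- Y i \<omega> - e) = - score (Y i \<omega> - (- e))" for i
              using score_minus[of "Y i \<omega> - (- e)"] by simp
            ultimately show ?thesis using \<omega> by (simp add: sum_negf)
          qed
          ultimately show "\<omega> \<in> (?A \<union> ?B) \<union> Bad n" by blast
        qed
        then have "prob {\<omega> \<in> space M. e < \<bar>T n \<omega>\<bar>} \<le> prob ((?A \<union> ?B) \<union> Bad n)"
          using PB by (intro finite_measure_mono sets.Un) measurable
        also have "\<dots> \<le> prob (?A \<union> ?B) + prob (Bad n)"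
          using PB by (intro measure_Un_le sets.Un) measurable
        also have "prob (?A \<union> ?B) \<le> prob ?A + prob ?B"
          by (intro measure_Un_le) measurable
        also have "prob ?A \<le> exp (- real n * e\<^sup>2 * J)" using elim by blast
        also have "prob ?B \<le> exp (- real n * e\<^sup>2 * J)" using elim by blast
        also have "prob (Bad n) \<le> K * exp (- real n * e\<^sup>2 * J)"
        proof -
          have "real n * (e\<^sup>2 * J) \<le> real n * c"
            using elim(3) by (intro mult_left_mono) auto
          then have "exp (- c * real n) \<le> exp (- real n * e\<^sup>2 * J)" by (simp add: algebra_simps)
          then have "K * exp (- c * real n) \<le> K * exp (- real n * e\<^sup>2 * J)" using K by (intro mult_left_mono)
          with PB(2)[of n] show ?thesis by linarith
        qed
        finally show "prob {\<omega> \<in> space M. e < \<bar>T n \<omega>\<bar>} \<le> (K + 2) * exp (- real n * e\<^sup>2 * J)"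
          by (simp add: algebra_simps)
      qed
    qed
  qed (use K in simp)
qed

text \<open>The right tail alone already has the full rate: outside \<open>Bad\<close>, a positive
  score sum at \<open>e\<close> forces a deviation.\<close>

lemma prob_minimizer_lower:
  assumes \<delta>: "\<delta> > 0"
  shows "\<exists>L. \<forall>\<^sub>F e in at_right 0. \<forall>n. L \<le> real n * e\<^sup>2 \<longrightarrow>
    exp (- real n * e\<^sup>2 * (2 * m\<^sup>2 * V + \<delta>)) \<le> prob {\<omega> \<in> space M. e < \<bar>T n \<omega>\<bar>}"
proof -
  obtain r Bad where r: "0 < r" and Bad: "exp_negligible Bad" and good:
    "\<And>n \<omega> e. \<omega> \<in> space M - Bad n \<Longrightarrow> \<bar>e\<bar> \<le> r \<Longrightarrow> e < T n \<omega> \<longleftrightarrow> 0 < (\<Sum>i<n. score (Y i \<omega> - e))"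
    using minimizer_events by blast
  from Bad obtain K c where K: "K \<ge> 0" "c > 0"
    and PB: "\<And>n. Bad n \<in> events" "\<And>n. prob (Bad n) \<le> K * exp (- c * real n)"
    unfolding exp_negligible_def by blast
  define J where "J = 2 * m\<^sup>2 * V + \<delta>"
  have "((\<lambda>e. e\<^sup>2 * J) \<longlongrightarrow> 0\<^sup>2 * J) (at_right 0)" by (intro tendsto_intros)
  then have small: "\<forall>\<^sub>F e in at_right 0. e\<^sup>2 * J < c"
    by (rule order_tendstoD) (use K in simp)
  have er: "\<forall>\<^sub>F e in at_right 0. e \<in> {0<..<r}" by (rule eventually_at_right_real[OF r])
  from \<delta> have "\<delta> / 2 > 0" by simp
  from prob_score_lower[OF this] obtain L where L:
    "\<forall>\<^sub>F e in at_right 0. \<forall>n. L \<le> real n * e\<^sup>2 \<longrightarrow>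
      exp (- real n * e\<^sup>2 * (2 * m\<^sup>2 * V + \<delta> / 2)) \<le> prob {\<omega> \<in> space M. 0 < (\<Sum>i<n. score (Y i \<omega> - e))}"
    by blast
  \<comment> \<open>Only \<delta> / 2 is spent on the score event; the second bound lets the other
    half absorb the factor \<open>K + 1\<close> that arises on subtracting the exceptional
    event.\<close>
  define L' where "L' = max L (2 * ln (K + 1) / \<delta>)"
  show ?thesis
  proof (rule exI[of _ L'])
    show "\<forall>\<^sub>F e in at_right 0. \<forall>n. L' \<le> real n * e\<^sup>2 \<longrightarrow>
        exp (- real n * e\<^sup>2 * (2 * m\<^sup>2 * V + \<delta>)) \<le> prob {\<omega> \<in> space M. e < \<bar>T n \<omega>\<bar>}"
      using L small er unfolding J_def[symmetric]
    proof eventually_elim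
      case (elim e)
      show ?case
      proof (intro allI impI)
        fix n assume n: "L' \<le> real n * e\<^sup>2"
        let ?A = "{\<omega> \<in> space M. 0 < (\<Sum>i<n. score (Y i \<omega> - e))}"
        let ?P = "{\<omega> \<in> space M. e < \<bar>T n \<omega>\<bar>}"
        define E where "E = exp (- real n * e\<^sup>2 * J)"
        have "?A \<subseteq> ?P \<union> Bad n"
          using good[of _ n e] elim(3) by fastforce
        then have "prob ?A \<le> prob (?P \<union> Bad n)"
          using PB by (intro finite_measure_mono sets.Un) measurable
        also have "\<dots> \<le> prob ?P + prob (Bad n)"
          using PB by (intro measure_Un_le) measurable
        also have "prob (Bad n) \<le> K * E"
        proof -
          have "real n * (e\<^sup>2 * J) \<le> real n * c"
            using elim(2) by (intro mult_left_mono) auto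
          then have "exp (- c * real n) \<le> E" by (simp add: E_def algebra_simps)
          then have "K * exp (- c * real n) \<le> K * E" using K by (intro mult_left_mono)
          with PB(2)[of n] show ?thesis by linarith
        qed
        finally have 1: "prob ?A \<le> prob ?P + K * E" by simp
        have "(K + 1) * E \<le> exp (- real n * e\<^sup>2 * (2 * m\<^sup>2 * V + \<delta> / 2))"
        proof -
          have "ln (K + 1) \<le> real n * e\<^sup>2 * (\<delta> / 2)"
            using n \<delta> by (simp add: L'_def field_simps)
          then have "exp (ln (K + 1)) \<le> exp (real n * e\<^sup>2 * (\<delta> / 2))" by simp
          then have "(K + 1) * E \<le> exp (real n * e\<^sup>2 * (\<delta> / 2)) * E"
            using K by (intro mult_right_mono) (auto simp: E_def)
          also have "\<dots> = exp (- real n * e\<^sup>2 * (2 * m\<^sup>2 * V + \<delta> / 2))"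
            by (simp add: E_def J_def algebra_simps flip: exp_add)
          finally show ?thesis .
        qed
        also have "\<dots> \<le> prob ?A" using elim(1) n by (simp add: L'_def)
        finally show "E \<le> prob ?P" using 1 by (simp add: algebra_simps)
      qed
    qed
  qed
qed

end

end

section \<open>From exponential bounds to logarithmic rates\<close>

lemma elog_le: "0 < K \<Longrightarrow> p \<le> K * exp y \<Longrightarrow> elog p \<le> ereal (ln K + y)"
proof (cases "p > 0")
  case True
  assume "0 < K" "p \<le> K * exp y"
  then have "ln p \<le> ln (K * exp y)" using True by simp
  also have "\<dots> = ln K + y" using \<open>0 < K\<close> by (simp add: ln_mult)
  finally show ?thesis using True by (simp add: elog_def)
qed (simp add: elog_def)

lemma elog_ge: "exp y \<le> p \<Longrightarrow> ereal y \<le> elog p"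
proof -
  assume y: "exp y \<le> p"
  then have p: "0 < p" using exp_gt_zero less_le_trans by blast
  then show ?thesis using y by (simp add: elog_def ln_ge_iff)
qed

text \<open>The weight \<open>w\<close> is 1 / n for a fixed deviation and
  \<open>(lam n)\<^sup>2 / n\<close> for a shrinking one; in both cases it cancels
  \<open>n * e\<^sup>2\<close> up to a constant \<open>s\<close>, and the prefactor \<open>K\<close>
  disappears because \<open>w\<close> tends to 0.\<close>

lemma limsup_elog_le:
  fixes p w e :: "nat \<Rightarrow> real"
  assumes K: "K > 0" and p: "\<forall>\<^sub>F n in sequentially. p n \<le> K * exp (- real n * (e n)\<^sup>2 * c)"
    and w: "w \<longlonglongrightarrow> 0" "\<forall>\<^sub>F n in sequentially. 0 \<le> w n \<and> w n * (real n * (e n)\<^sup>2) = s"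
  shows "limsup (\<lambda>n. elog (p n) * ereal (w n)) \<le> ereal (- s * c)"
proof -
  have "\<forall>\<^sub>F n in sequentially. elog (p n) * ereal (w n) \<le> ereal (ln K * w n - s * c)"
    using p w(2)
  proof eventually_elim
    case (elim n)
    have "elog (p n) * ereal (w n) \<le> ereal (ln K + - real n * (e n)\<^sup>2 * c) * ereal (w n)"
      using elim K by (intro ereal_mult_right_mono elog_le) auto
    also have "\<dots> = ereal (ln K * w n - (w n * (real n * (e n)\<^sup>2)) * c)"
      by (simp add: algebra_simps)
    finally show ?case using elim by simp
  qed
  then have "limsup (\<lambda>n. elog (p n) * ereal (w n)) \<le> limsup (\<lambda>n. ereal (ln K * w n - s * c))"
    by (rule Limsup_mono)
  also have "\<dots> = ereal (ln K * 0 - s * c)"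
    by (intro lim_imp_Limsup tendsto_intros w) auto
  finally show ?thesis by simp
qed

lemma liminf_elog_ge:
  fixes p w e :: "nat \<Rightarrow> real"
  assumes p: "\<forall>\<^sub>F n in sequentially. exp (- real n * (e n)\<^sup>2 * c) \<le> p n"
    and w: "\<forall>\<^sub>F n in sequentially. 0 \<le> w n \<and> w n * (real n * (e n)\<^sup>2) = s"
  shows "ereal (- s * c) \<le> liminf (\<lambda>n. elog (p n) * ereal (w n))"
proof (rule Liminf_bounded)
  show "\<forall>\<^sub>F n in sequentially. ereal (- s * c) \<le> elog (p n) * ereal (w n)"
    using p w
  proof eventually_elim
    case (elim n)
    have "ereal (- s * c) = ereal (- (w n * (real n * (e n)\<^sup>2)) * c)" using elim by simp
    also have "\<dots> = ereal (- real n * (e n)\<^sup>2 * c) * ereal (w n)"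
      by (simp add: algebra_simps)
    also have "\<dots> \<le> elog (p n) * ereal (w n)"
      using elim by (intro ereal_mult_right_mono elog_ge) auto
    finally show ?case .
  qed
qed

section \<open>Rates from upper and lower bounds uniform in the sample size\<close>

context
  fixes p :: "nat \<Rightarrow> real \<Rightarrow> real" and J :: real
  assumes upper: "\<And>\<delta>. 0 < \<delta> \<Longrightarrow> \<exists>K>0. \<forall>\<^sub>F e in at_right 0. \<forall>n.
      p n e \<le> K * exp (- real n * e\<^sup>2 * (J - \<delta>))"
    and lower: "\<And>\<delta>. 0 < \<delta> \<Longrightarrow> \<exists>L. \<forall>\<^sub>F e in at_right 0. \<forall>n. L \<le> real n * e\<^sup>2 \<longrightarrow>
      exp (- real n * e\<^sup>2 * (J + \<delta>)) \<le> p n e"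
begin

lemma Limsup_rate:
  "Limsup (at_right 0) (\<lambda>e. ereal (1 / e\<^sup>2) * limsup (\<lambda>n. elog (p n e) * ereal (1 / real n))) \<le> ereal (- J)"
proof (rule ereal_le_epsilon2)
  fix \<delta> :: real assume "0 < \<delta>"
  then obtain K where K: "K > 0"
    and ev: "\<forall>\<^sub>F e in at_right 0. \<forall>n. p n e \<le> K * exp (- real n * e\<^sup>2 * (J - \<delta>))"
    using upper by blast
  have "\<forall>\<^sub>F e in at_right 0. ereal (1 / e\<^sup>2) * limsup (\<lambda>n. elog (p n e) * ereal (1 / real n))
      \<le> ereal (- J) + ereal \<delta>"
    using ev eventually_at_right_less[of 0]
  proof eventually_elim
    case (elim e)
    have "limsup (\<lambda>n. elog (p n e) * ereal (1 / real n)) \<le> ereal (- e\<^sup>2 * (J - \<delta>))"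
    proof (rule limsup_elog_le[OF K, where e = "\<lambda>_. e"])
      show "\<forall>\<^sub>F n in sequentially. 0 \<le> 1 / real n \<and> 1 / real n * (real n * e\<^sup>2) = e\<^sup>2"
        using eventually_gt_at_top[of 0] by eventually_elim auto
    qed (use elim in \<open>auto intro: lim_1_over_n\<close>)
    then have "ereal (1 / e\<^sup>2) * limsup (\<lambda>n. elog (p n e) * ereal (1 / real n))
        \<le> ereal (1 / e\<^sup>2) * ereal (- e\<^sup>2 * (J - \<delta>))"
      by (rule ereal_mult_left_mono) simp
    also have "\<dots> = ereal (- J) + ereal \<delta>" using elim by simp
    finally show ?case .
  qed
  then show "Limsup (at_right 0) (\<lambda>e. ereal (1 / e\<^sup>2) * limsup (\<lambda>n. elog (p n e) * ereal (1 / real n)))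
      \<le> ereal (- J) + ereal \<delta>"
    by (rule Limsup_bounded)
qed

lemma Liminf_rate:
  "ereal (- J) \<le> Liminf (at_right 0) (\<lambda>e. ereal (1 / e\<^sup>2) * liminf (\<lambda>n. elog (p n e) * ereal (1 / real n)))"
    (is "_ \<le> ?R")
proof (rule ereal_le_epsilon2)
  fix \<delta> :: real assume "0 < \<delta>"
  then obtain L where ev: "\<forall>\<^sub>F e in at_right 0. \<forall>n. L \<le> real n * e\<^sup>2 \<longrightarrow>
      exp (- real n * e\<^sup>2 * (J + \<delta>)) \<le> p n e"
    using lower by blast
  have "\<forall>\<^sub>F e in at_right 0. ereal (- (J + \<delta>))
      \<le> ereal (1 / e\<^sup>2) * liminf (\<lambda>n. elog (p n e) * ereal (1 / real n))"
    using ev eventually_at_right_less[of 0]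
  proof eventually_elim
    case (elim e)
    have "ereal (- e\<^sup>2 * (J + \<delta>)) \<le> liminf (\<lambda>n. elog (p n e) * ereal (1 / real n))"
    proof (rule liminf_elog_ge[where e = "\<lambda>_. e"])
      show "\<forall>\<^sub>F n in sequentially. 0 \<le> 1 / real n \<and> 1 / real n * (real n * e\<^sup>2) = e\<^sup>2"
        using eventually_gt_at_top[of 0] by eventually_elim auto
      have "filterlim (\<lambda>n. real n * e\<^sup>2) at_top sequentially"
        using elim by (intro filterlim_at_top_mult_tendsto_pos[OF tendsto_const] filterlim_real_sequentially) simp
      then have "\<forall>\<^sub>F n in sequentially. L \<le> real n * e\<^sup>2"
        by (simp add: filterlim_at_top)
      then show "\<forall>\<^sub>F n in sequentially. exp (- real n * e\<^sup>2 * (J + \<delta>)) \<le> p n e"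
        using elim by (auto elim: eventually_mono)
    qed
    then have "ereal (1 / e\<^sup>2) * ereal (- e\<^sup>2 * (J + \<delta>))
        \<le> ereal (1 / e\<^sup>2) * liminf (\<lambda>n. elog (p n e) * ereal (1 / real n))"
      by (rule ereal_mult_left_mono) simp
    then show ?case using elim by simp
  qed
  then have "ereal (- (J + \<delta>)) \<le> ?R" by (rule Liminf_bounded)
  then have "ereal (- (J + \<delta>)) + ereal \<delta> \<le> ?R + ereal \<delta>" by (rule add_right_mono)
  then show "ereal (- J) \<le> ?R + ereal \<delta>" by simp
qed

text \<open>Substitute \<open>e = \<epsilon> / lam n\<close> in the uniform bounds. Divergence of
  \<open>lam\<close> brings \<open>e\<close> into the right neighbourhood of 0; slowness against the
  square root makes \<open>n * e\<^sup>2\<close> diverge, as the lower bound requires, and the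
  weight vanish, as the upper one does.\<close>

lemma moderate_deviation_rate:
  fixes lam :: "nat \<Rightarrow> real"
  assumes pos: "\<And>n. 0 < lam n" and lim: "filterlim lam at_top sequentially"
    and slow: "(\<lambda>n. lam n / sqrt (real n)) \<longlonglongrightarrow> 0" and \<epsilon>: "0 < \<epsilon>"
  shows "(\<lambda>n. elog (p n (\<epsilon> / lam n)) * ereal ((lam n)\<^sup>2 / real n)) \<longlonglongrightarrow> ereal (- J * \<epsilon>\<^sup>2)"
proof -
  let ?e = "\<lambda>n. \<epsilon> / lam n" and ?w = "\<lambda>n. (lam n)\<^sup>2 / real n"
  let ?f = "\<lambda>n. elog (p n (?e n)) * ereal (?w n)"
  have e: "filterlim ?e (at_right 0) sequentially"
    unfolding filterlim_at
  proof
    show "?e \<longlonglongrightarrow> 0"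
      by (rule tendsto_divide_0[OF tendsto_const]) (rule filterlim_mono[OF lim at_top_le_at_infinity order_refl])
    show "\<forall>\<^sub>F n in sequentially. ?e n \<in> {0<..} \<and> ?e n \<noteq> 0"
      using pos \<epsilon> by (auto simp: less_imp_neq[symmetric] intro!: always_eventually)
  qed
  have w0: "?w \<longlonglongrightarrow> 0"
    using tendsto_power[OF slow, of 2] by (simp add: power_divide)
  have ws: "\<forall>\<^sub>F n in sequentially. 0 \<le> ?w n \<and> ?w n * (real n * (?e n)\<^sup>2) = \<epsilon>\<^sup>2"
    using eventually_gt_at_top[of 0]
  proof eventually_elim
    case (elim n)
    then show ?case using pos[of n] by (simp add: power_divide)
  qed
  have inf: "filterlim (\<lambda>n. real n * (?e n)\<^sup>2) at_top sequentially"
  proof -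
    have "\<forall>\<^sub>F n in sequentially. 0 < ?w n"
      using eventually_gt_at_top[of 0] by eventually_elim (intro divide_pos_pos zero_less_power pos; simp)
    then have "filterlim (\<lambda>n. inverse (?w n)) at_top sequentially"
      by (rule filterlim_inverse_at_top[OF w0])
    then have "filterlim (\<lambda>n. \<epsilon>\<^sup>2 * inverse (?w n)) at_top sequentially"
      by (rule filterlim_tendsto_pos_mult_at_top[OF tendsto_const, rotated]) (use \<epsilon> in simp)
    then show ?thesis by (simp add: power_divide mult.commute)
  qed
  have "limsup ?f \<le> ereal (- J * \<epsilon>\<^sup>2)"
  proof (rule ereal_le_epsilon2)
    fix \<delta> :: real assume \<delta>: "0 < \<delta>"
    then have "0 < \<delta> / \<epsilon>\<^sup>2" using \<epsilon> by simp
    from upper[OF this] obtain K where K: "K > 0"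
      and ev: "\<forall>\<^sub>F e in at_right 0. \<forall>n. p n e \<le> K * exp (- real n * e\<^sup>2 * (J - \<delta> / \<epsilon>\<^sup>2))"
      by blast
    have "\<forall>\<^sub>F n in sequentially. p n (?e n) \<le> K * exp (- real n * (?e n)\<^sup>2 * (J - \<delta> / \<epsilon>\<^sup>2))"
      using eventually_compose_filterlim[OF ev e] by (auto elim: eventually_mono)
    from limsup_elog_le[OF K this w0 ws]
    have "limsup ?f \<le> ereal (- \<epsilon>\<^sup>2 * (J - \<delta> / \<epsilon>\<^sup>2))" .
    also have "- \<epsilon>\<^sup>2 * (J - \<delta> / \<epsilon>\<^sup>2) = - J * \<epsilon>\<^sup>2 + \<delta>" using \<epsilon> by (simp add: field_simps)
    finally show "limsup ?f \<le> ereal (- J * \<epsilon>\<^sup>2) + ereal \<delta>" by simp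
  qed
  moreover have "ereal (- J * \<epsilon>\<^sup>2) \<le> liminf ?f"
  proof (rule ereal_le_epsilon2)
    fix \<delta> :: real assume \<delta>: "0 < \<delta>"
    then have "0 < \<delta> / \<epsilon>\<^sup>2" using \<epsilon> by simp
    from lower[OF this] obtain L where ev: "\<forall>\<^sub>F e in at_right 0. \<forall>n. L \<le> real n * e\<^sup>2 \<longrightarrow>
        exp (- real n * e\<^sup>2 * (J + \<delta> / \<epsilon>\<^sup>2)) \<le> p n e"
      by blast
    have "\<forall>\<^sub>F n in sequentially. L \<le> real n * (?e n)\<^sup>2"
      using inf unfolding filterlim_at_top by blast
    with eventually_compose_filterlim[OF ev e]
    have "\<forall>\<^sub>F n in sequentially. exp (- real n * (?e n)\<^sup>2 * (J + \<delta> / \<epsilon>\<^sup>2)) \<le> p n (?e n)"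
      by eventually_elim blast
    from liminf_elog_ge[OF this ws]
    have "ereal (- \<epsilon>\<^sup>2 * (J + \<delta> / \<epsilon>\<^sup>2)) \<le> liminf ?f" .
    also have "- \<epsilon>\<^sup>2 * (J + \<delta> / \<epsilon>\<^sup>2) = - J * \<epsilon>\<^sup>2 - \<delta>" using \<epsilon> by (simp add: field_simps)
    finally have "ereal (- J * \<epsilon>\<^sup>2 - \<delta>) + ereal \<delta> \<le> liminf ?f + ereal \<delta>" by (rule add_right_mono)
    then show "ereal (- J * \<epsilon>\<^sup>2) \<le> liminf ?f + ereal \<delta>" by simp
  qed
  moreover have "liminf ?f \<le> limsup ?f" by (intro Liminf_le_Limsup) simp
  ultimately show ?thesis
    by (subst tendsto_iff_Liminf_eq_Limsup) auto
qed

end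

section \<open>Reduction of the theorem to the centred sample\<close>

lemma distr_shift_pvii:
  assumes "distributed M lborel X (\<lambda>x. ennreal (pvii_f m (x - \<theta>)))"
  shows "distr M borel (\<lambda>\<omega>. X \<omega> - \<theta>) = pvii_law m"
proof -
  have X [measurable]: "X \<in> borel_measurable M"
    using distributed_measurable[OF assms] by simp
  have "distr M borel (\<lambda>\<omega>. X \<omega> - \<theta>) = distr (distr M lborel X) borel (\<lambda>x. x - \<theta>)"
    by (subst distr_distr) (auto simp: comp_def)
  also have "distr M lborel X = density lborel (\<lambda>x. ennreal (pvii_f m (x - \<theta>)))"
    by (rule distributed_distr_eq_density[OF assms])
  also have "distr \<dots> borel (\<lambda>x. x - \<theta>) = density (distr lborel borel (\<lambda>x. x - \<theta>)) (\<lambda>x. ennreal (pvii_f m x))"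
    by (subst density_distr) auto
  also have "(\<lambda>x. x - \<theta>) = (+) (- \<theta>)"
    by (simp add: fun_eq_iff)
  also have "distr lborel borel ((+) (- \<theta>)) = lborel"
    by (rule lborel_distr_plus)
  finally show ?thesis by (simp add: pvii_law_def)
qed

lemma sum_ln_le_of_likelihood_le:
  fixes x y :: "nat \<Rightarrow> real"
  assumes m: "m > 1/2"
    and le: "(\<Prod>i<n. pvii_f m (x i)) \<le> (\<Prod>i<n. pvii_f m (y i))"
  shows "(\<Sum>i<n. ln (1 + (y i)\<^sup>2)) \<le> (\<Sum>i<n. ln (1 + (x i)\<^sup>2))"
proof -
  have c: "pvii_c m > 0" using kernel_integral_pos[OF m] by (simp add: pvii_c_eq)
  have ln_f: "ln (pvii_f m z) = ln (pvii_c m) - m * ln (1 + z\<^sup>2)" for z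
    using c by (simp add: pvii_f_def ln_mult ln_powr)
  have ln_lik: "ln (\<Prod>i<n. pvii_f m (z i)) = n * ln (pvii_c m) - m * (\<Sum>i<n. ln (1 + (z i)\<^sup>2))"
    for z :: "nat \<Rightarrow> real"
  proof -
    have "pvii_f m (z i) \<noteq> 0" for i using pvii_f_pos[OF m, of "z i"] by simp
    then show ?thesis
      by (subst ln_prod) (auto simp: ln_f sum_subtractf sum_distrib_left)
  qed
  have "ln (\<Prod>i<n. pvii_f m (x i)) \<le> ln (\<Prod>i<n. pvii_f m (y i))"
    using le by (subst ln_le_cancel_iff) (auto intro!: prod_pos pvii_f_pos[OF m])
  then show ?thesis using m unfolding ln_lik by simp
qed

theorem theorem1p4:
  fixes M :: "'a measure" and m \<theta> :: real
    and X :: "nat \<Rightarrow> 'a \<Rightarrow> real"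
    and est :: "nat \<Rightarrow> (nat \<Rightarrow> real) \<Rightarrow> real"
  assumes "prob_space M"
    and m: "m > 1/2"
    and indep: "prob_space.indep_vars M (\<lambda>_. borel) X UNIV"
    and distr: "\<And>i. distributed M lborel (X i) (\<lambda>x. ennreal (pvii_f m (x - \<theta>)))"
    and est_meas: "\<And>n. est n \<in> borel_measurable (Pi\<^sub>M {..<n} (\<lambda>_. borel))"
    and est_max: "\<And>n xs t. xs \<in> space (Pi\<^sub>M {..<n} (\<lambda>_. borel)) \<Longrightarrow>
        (\<Prod>i<n. pvii_f m (xs i - t)) \<le> (\<Prod>i<n. pvii_f m (xs i - est n xs))"
  defines "\<theta>hat \<equiv> (\<lambda>n \<omega>. est n (restrict (\<lambda>i. X i \<omega>) {..<n}))"
    and "I \<equiv> - (m * (2 * m - 1)) / (2 * (m + 1))"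
  shows
    "Limsup (at_right 0) (\<lambda>\<epsilon>. ereal (1 / \<epsilon>\<^sup>2) *
        limsup (\<lambda>n. elog (measure M {\<omega> \<in> space M. \<bar>\<theta>hat n \<omega> - \<theta>\<bar> > \<epsilon>}) * ereal (1 / real n)))
       \<le> ereal I \<and>
     Liminf (at_right 0) (\<lambda>\<epsilon>. ereal (1 / \<epsilon>\<^sup>2) *
        liminf (\<lambda>n. elog (measure M {\<omega> \<in> space M. \<bar>\<theta>hat n \<omega> - \<theta>\<bar> > \<epsilon>}) * ereal (1 / real n)))
       \<ge> ereal I \<and>
     (\<forall>(lam :: nat \<Rightarrow> real) \<epsilon>. (\<forall>n. lam n > 0) \<longrightarrow> filterlim lam at_top sequentially \<longrightarrow>
        (\<lambda>n. lam n / sqrt (real n)) \<longlonglongrightarrow> 0 \<longrightarrow> \<epsilon> > 0 \<longrightarrow>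
        ((\<lambda>n. elog (measure M {\<omega> \<in> space M. \<bar>\<theta>hat n \<omega> - \<theta>\<bar> > \<epsilon> / lam n})
                * ereal ((lam n)\<^sup>2 / real n))
          \<longlongrightarrow> ereal (I * \<epsilon>\<^sup>2)) sequentially)"
proof -
  interpret prob_space M by fact
  have X_meas [measurable]: "X i \<in> borel_measurable M" for i
    using indep by (auto simp: indep_vars_def)
  let ?Y = "\<lambda>i \<omega>. X i \<omega> - \<theta>"
  interpret pvii_sample M m ?Y
  proof
    show "indep_vars (\<lambda>_. borel) ?Y UNIV"
      by (rule indep_vars_compose2[OF indep]) measurable
  qed (rule distr_shift_pvii[OF distr], rule m)
  have data_meas: "(\<lambda>\<omega>. restrict (\<lambda>i. X i \<omega>) {..<n}) \<in> M \<rightarrow>\<^sub>M Pi\<^sub>M {..<n} (\<lambda>_. borel)" for n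
    by (intro measurable_restrict) measurable
  define T where "T = (\<lambda>n \<omega>. \<theta>hat n \<omega> - \<theta>)"
  have T_meas: "T n \<in> borel_measurable M" for n
    unfolding T_def \<theta>hat_def
    by (intro borel_measurable_diff measurable_compose[OF data_meas est_meas]) simp
  have T_min: "(\<Sum>i<n. ln (1 + (?Y i \<omega> - T n \<omega>)\<^sup>2)) \<le> (\<Sum>i<n. ln (1 + (?Y i \<omega> - t)\<^sup>2))"
    if \<omega>: "\<omega> \<in> space M" for n \<omega> t
  proof -
    let ?xs = "restrict (\<lambda>i. X i \<omega>) {..<n}"
    \<comment> \<open>A competitor \<open>t\<close> for the centred data is the competitor
      \<open>t + \<theta>\<close> for the original data.\<close>
    have "(\<Prod>i<n. pvii_f m (?xs i - (t + \<theta>))) \<le> (\<Prod>i<n. pvii_f m (?xs i - est n ?xs))"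
      by (rule est_max[OF measurable_space[OF data_meas \<omega>]])
    from sum_ln_le_of_likelihood_le[OF m this] show ?thesis
      by (simp add: T_def \<theta>hat_def algebra_simps)
  qed
  have "2 * m\<^sup>2 * V = (2 * m\<^sup>2 * (2 * m - 1)) / (4 * m * (m + 1))"
    by (simp add: score_var_def[OF m])
  also have "\<dots> = (m * (2 * m - 1)) / (2 * (m + 1))"
    using m by (subst frac_eq_eq) (auto simp: power2_eq_square)
  finally have I: "- (2 * m\<^sup>2 * V) = I" by (simp add: I_def)
  note upper = prob_minimizer_upper[OF T_meas T_min]
  note lower = prob_minimizer_lower[OF T_meas T_min]
  show ?thesis
    using Limsup_rate[OF upper lower] Liminf_rate[OF upper lower]
      moderate_deviation_rate[OF upper lower]
    unfolding I T_def by blast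
qed

end
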